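(* Let $l\in\mathbb{C}$, $l\neq 0$. For $n\geq -1$, the operators $L(n)$ on $M(l)$ satisfy the Virasoro Lie algebra relations; that is, for all integers $m,n\geq -1$, $$[L(m),L(n)]=(m-n)L(m+n).$$
   Context: $\mathbb{N}=\{0,1,2,\dots\}$. $\mathfrak{h}$ is a finite-dimensional abelian Lie algebra over $\mathbb{C}$ with a nondegenerate symmetric bilinear form $\langle\cdot,\cdot\rangle$ and an orthonormal basis $u^{(1)},\dots,u^{(d)}$. $\mathfrak{h}[t]=\mathfrak{h}\otimes\mathbb{C}[t]$ is the (abelian) current algebra; $xt^j$ means $x\otimes t^j$. The affinization is $\widehat{\mathfrak{h}[t]}=\mathfrak{h}[t]\otimes\mathbb{C}[s,s^{-1}]\oplus\mathbb{C}\mathbf{k}$ with $\mathbf{k}$ central and $[xt^i\otimes s^m,yt^j\otimes s^n]=m\langle x,y\rangle\delta_{m+n,0}\delta_{i,j}\mathbf{k}$. For $a\in\mathfrak{h}[t]$, $n\in\mathbb{Z}$, $a(n)$ denotes the action of $a\otimes s^n$ on a module. $M(l)=U(\widehat{\mathfrak{h}[t]})\otimes_{U(\mathfrak{h}[t]\otimes\mathbb{C}[s]\oplus\mathbb{C}\mathbf{k})}\mathbb{C}\mathbf{1}$ is the induced module where $\mathfrak{h}[t]\otimes\mathbb{C}[s]$ annihilates $\mathbf{1}$ and $\mathbf{k}$ acts as $l$; as a vector space $M(l)=S(\mathfrak{h}[t]\otimes s^{-1}\mathbb{C}[s^{-1}])\otimes\mathbb{C}\mathbf{1}$. Normal ordering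 $:\ :$ places operators $a(n)$ with $n\geq 0$ to the right of those with $n<0$. For $n\geq -1$, $$L(n)=\frac{1}{2l}\sum_{i=1}^d\sum_{j\in\mathbb{N}}\sum_{m\in\mathbb{Z}}:(u^{(i)}t^j)(n-m)\,(u^{(i)}t^j)(m):$$ (on each vector of $M(l)$ only finitely many terms are nonzero). *)

theory Defs
  imports
    Complex_Main
    "HOL-Library.Poly_Mapping"
    "HOL-Library.Product_Plus"
    "HOL-Computational_Algebra.Polynomial"
    "HOL-Algebra.QuotRing"
    "HOL-Algebra.Module"
    "HOL-Algebra.Free_Abelian_Groups"
begin

section \<open>Universal enveloping algebras\<close>

text \<open>
  Words under concatenation form the free monoid, so the monoid algebra
  \<open>'g word \<Rightarrow>\<^sub>0 complex\<close>, with the convolution product of Poly_Mapping, is the free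
  associative unital complex algebra on the set of all elements of \<open>'g\<close>.
\<close>

datatype 'g word = Word (letters: "'g list")

instantiation word :: (type) monoid_add
begin

definition zero_word :: "'a word" where
  "zero_word = Word []"

definition plus_word :: "'a word \<Rightarrow> 'a word \<Rightarrow> 'a word" where
  "plus_word v w = Word (letters v @ letters w)"

instance
  by standard (simp_all add: zero_word_def plus_word_def)

end

type_synonym 'g free_alg = "'g word \<Rightarrow>\<^sub>0 complex"

definition gen :: "'g \<Rightarrow> 'g free_alg" where
  "gen x = Poly_Mapping.single (Word [x]) 1"

definition const :: "complex \<Rightarrow> 'g free_alg" where
  "const c = Poly_Mapping.single 0 c"

definition free_algebra :: "'g set \<Rightarrow> 'g free_alg ring" where
  "free_algebra P =
     \<lparr>carrier = {f. \<forall>w \<in> Poly_Mapping.keys f. set (letters w) \<subseteq> P},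
      monoid.mult = (*), monoid.one = 1, ring.zero = 0, ring.add = (+)\<rparr>"

text \<open>
  A complex Lie algebra is given by a type \<open>'g\<close> with scalar multiplication \<open>sc\<close> and bracket
  \<open>br\<close>; \<open>P\<close> is (the carrier of) a Lie subalgebra. The first two families of relators
  turn the free algebra on the set \<open>P\<close> into the tensor algebra of the vector space \<open>P\<close>.
\<close>

definition env_relators ::
  "(complex \<Rightarrow> 'g \<Rightarrow> 'g) \<Rightarrow> ('g \<Rightarrow> 'g \<Rightarrow> 'g) \<Rightarrow> 'g::ab_group_add set \<Rightarrow> 'g free_alg set" where
  "env_relators sc br P =
     {gen (x + y) - gen x - gen y | x y. x \<in> P \<and> y \<in> P} \<union>
     {gen (sc c x) - const c * gen x | c x. x \<in> P} \<union>
     {gen x * gen y - gen y * gen x - gen (br x y) | x y. x \<in> P \<and> y \<in> P}"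

definition env_ideal ::
  "(complex \<Rightarrow> 'g \<Rightarrow> 'g) \<Rightarrow> ('g \<Rightarrow> 'g \<Rightarrow> 'g) \<Rightarrow> 'g::ab_group_add set \<Rightarrow> 'g free_alg set" where
  "env_ideal sc br P = genideal (free_algebra P) (env_relators sc br P)"

definition env_algebra ::
  "(complex \<Rightarrow> 'g \<Rightarrow> 'g) \<Rightarrow> ('g \<Rightarrow> 'g \<Rightarrow> 'g) \<Rightarrow> 'g::ab_group_add set \<Rightarrow> 'g free_alg set ring" where
  "env_algebra sc br P = free_algebra P Quot env_ideal sc br P"

definition env_class ::
  "(complex \<Rightarrow> 'g \<Rightarrow> 'g) \<Rightarrow> ('g \<Rightarrow> 'g \<Rightarrow> 'g) \<Rightarrow> 'g free_alg \<Rightarrow> 'g::ab_group_add free_alg set" where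
  "env_class sc br f = env_ideal sc br UNIV +>\<^bsub>free_algebra UNIV\<^esub> f"

text \<open>The canonical map from the enveloping algebra of a subalgebra to that of \<open>'g\<close>.\<close>

definition env_incl ::
  "(complex \<Rightarrow> 'g \<Rightarrow> 'g) \<Rightarrow> ('g \<Rightarrow> 'g \<Rightarrow> 'g) \<Rightarrow> 'g::ab_group_add free_alg set \<Rightarrow> 'g free_alg set" where
  "env_incl sc br X = (\<Union>f\<in>X. env_class sc br f)"

text \<open>
  A representation \<open>\<rho>\<close> of the Lie subalgebra on \<open>'w\<close>, with scalar multiplication \<open>scw\<close>,
  extends to its enveloping algebra. In \<open>env_rep\<close> the image of a coset is a singleton because
  \<open>\<rho>\<close> respects the relators.
\<close>

definition free_rep ::
  "(complex \<Rightarrow> 'w \<Rightarrow> 'w) \<Rightarrow> ('g \<Rightarrow> 'w \<Rightarrow> 'w) \<Rightarrow> 'g free_alg \<Rightarrow> 'w \<Rightarrow> 'w::ab_group_add" where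
  "free_rep scw \<rho> f b =
     (\<Sum>w \<in> Poly_Mapping.keys f. scw (Poly_Mapping.lookup f w) (foldr \<rho> (letters w) b))"

definition env_rep ::
  "(complex \<Rightarrow> 'w \<Rightarrow> 'w) \<Rightarrow> ('g \<Rightarrow> 'w \<Rightarrow> 'w) \<Rightarrow> 'g free_alg set \<Rightarrow> 'w \<Rightarrow> 'w::ab_group_add" where
  "env_rep scw \<rho> X b = the_elem ((\<lambda>f. free_rep scw \<rho> f b) ` X)"


section \<open>Induced modules\<close>

text \<open>
  The tensor product over a ring \<open>R\<close> of a right \<open>R\<close>-module (the additive group of \<open>A\<close>, with
  action \<open>ract\<close>) and a left \<open>R\<close>-module (the type \<open>'w\<close>, with action \<open>lact\<close>): the free abelian
  group on the pairs, modulo biadditivity and balancedness. It is written multiplicatively, as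
  are all groups of HOL-Algebra.
\<close>

definition tensor_relators ::
  "('a, 'm) ring_scheme \<Rightarrow> ('r, 'n) ring_scheme \<Rightarrow> ('a \<Rightarrow> 'r \<Rightarrow> 'a) \<Rightarrow> ('r \<Rightarrow> 'w \<Rightarrow> 'w)
     \<Rightarrow> ('a \<times> 'w::ab_group_add \<Rightarrow>\<^sub>0 int) set" where
  "tensor_relators A R ract lact =
     {frag_of (a \<oplus>\<^bsub>A\<^esub> a', b) - frag_of (a, b) - frag_of (a', b)
        | a a' b. a \<in> carrier A \<and> a' \<in> carrier A} \<union>
     {frag_of (a, b + b') - frag_of (a, b) - frag_of (a, b') | a b b'. a \<in> carrier A} \<union>
     {frag_of (ract a r, b) - frag_of (a, lact r b) | a r b. a \<in> carrier A \<and> r \<in> carrier R}"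

definition tensor_free ::
  "('a, 'm) ring_scheme \<Rightarrow> ('a \<times> 'w \<Rightarrow>\<^sub>0 int) monoid" where
  "tensor_free A = free_Abelian_group (carrier A \<times> UNIV)"

definition tensor_null ::
  "('a, 'm) ring_scheme \<Rightarrow> ('r, 'n) ring_scheme \<Rightarrow> ('a \<Rightarrow> 'r \<Rightarrow> 'a) \<Rightarrow> ('r \<Rightarrow> 'w \<Rightarrow> 'w)
     \<Rightarrow> ('a \<times> 'w::ab_group_add \<Rightarrow>\<^sub>0 int) set" where
  "tensor_null A R ract lact = generate (tensor_free A) (tensor_relators A R ract lact)"

definition tensor_product ::
  "('a, 'm) ring_scheme \<Rightarrow> ('r, 'n) ring_scheme \<Rightarrow> ('a \<Rightarrow> 'r \<Rightarrow> 'a) \<Rightarrow> ('r \<Rightarrow> 'w \<Rightarrow> 'w)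
     \<Rightarrow> ('a \<times> 'w::ab_group_add \<Rightarrow>\<^sub>0 int) set monoid" where
  "tensor_product A R ract lact = tensor_free A Mod tensor_null A R ract lact"

text \<open>
  The module induced from the representation \<open>\<rho>\<close> of the subalgebra \<open>P\<close> on \<open>'w\<close> is
  \<open>U('g) \<otimes> 'w\<close>, the tensor product being taken over \<open>U(P)\<close>. \<open>U('g)\<close> acts by left
  multiplication on the first factor; \<open>ind_act\<close> is the map this induces on cosets.
\<close>

type_synonym ('g, 'w) ind = "('g free_alg set \<times> 'w \<Rightarrow>\<^sub>0 int) set"

context
  fixes sc :: "complex \<Rightarrow> 'g::ab_group_add \<Rightarrow> 'g"
    and br :: "'g \<Rightarrow> 'g \<Rightarrow> 'g"
    and P :: "'g set"
    and scw :: "complex \<Rightarrow> 'w::ab_group_add \<Rightarrow> 'w"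
    and \<rho> :: "'g \<Rightarrow> 'w \<Rightarrow> 'w"
begin

definition ind_null :: "('g, 'w) ind" where
  "ind_null =
     tensor_null (env_algebra sc br UNIV) (env_algebra sc br P)
       (\<lambda>a r. a \<otimes>\<^bsub>env_algebra sc br UNIV\<^esub> env_incl sc br r) (env_rep scw \<rho>)"

definition ind_group :: "('g, 'w) ind monoid" where
  "ind_group =
     tensor_product (env_algebra sc br UNIV) (env_algebra sc br P)
       (\<lambda>a r. a \<otimes>\<^bsub>env_algebra sc br UNIV\<^esub> env_incl sc br r) (env_rep scw \<rho>)"

definition ind_act :: "'g free_alg set \<Rightarrow> ('g, 'w) ind \<Rightarrow> ('g, 'w) ind" where
  "ind_act X v =
     (\<Union>z\<in>v. ind_null #>\<^bsub>tensor_free (env_algebra sc br UNIV)\<^esub>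
        frag_extend (\<lambda>(a, b). frag_of (X \<otimes>\<^bsub>env_algebra sc br UNIV\<^esub> a, b)) z)"

text \<open>
  As a complex vector space. Only the additive structure and the scalar multiplication matter:
  the fields \<open>mult\<close> and \<open>one\<close> of the record type have no meaning for modules.
\<close>

definition ind_module :: "(complex, ('g, 'w) ind) module" where
  "ind_module =
     \<lparr>carrier = carrier ind_group, monoid.mult = undefined, monoid.one = undefined,
      ring.zero = monoid.one ind_group, ring.add = monoid.mult ind_group,
      smult = (\<lambda>c. ind_act (env_class sc br (const c)))\<rparr>"

end


section \<open>The affinization of the current algebra\<close>

text \<open>
  \<open>\<hh>\<close> is the type \<open>'h\<close> with scalar multiplication \<open>scale\<close> and form \<open>form\<close>; its bracket is
  zero. The current algebra is \<open>'h poly\<close>, where \<open>monom x j\<close> is \<open>x t\<^sup>j\<close>. An element of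
  its affinization is a pair \<open>(f, c)\<close> standing for the sum of all
  \<open>f\<^sub>m \<otimes> s\<^sup>m\<close> plus \<open>c\<close> times the central element.
\<close>

type_synonym 'h affine = "(int \<Rightarrow>\<^sub>0 'h poly) \<times> complex"

definition aff_scale ::
  "(complex \<Rightarrow> 'h \<Rightarrow> 'h) \<Rightarrow> complex \<Rightarrow> 'h::ab_group_add affine \<Rightarrow> 'h affine" where
  "aff_scale scale c = (\<lambda>(f, a). (Poly_Mapping.map (map_poly (scale c)) f, c * a))"

text \<open>The bilinear extension of
  \<open>[x t\<^sup>i \<otimes> s\<^sup>m, y t\<^sup>j \<otimes> s\<^sup>n] = m form(x,y) \<delta>(m+n,0) \<delta>(i,j) k\<close>.\<close>

definition aff_bracket ::
  "('h \<Rightarrow> 'h \<Rightarrow> complex) \<Rightarrow> 'h::ab_group_add affine \<Rightarrow> 'h affine \<Rightarrow> 'h affine" where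
  "aff_bracket form = (\<lambda>(f, a) (g, b).
     (0, \<Sum>m \<in> Poly_Mapping.keys f. of_int m *
           (\<Sum>i \<le> degree (Poly_Mapping.lookup f m).
              form (coeff (Poly_Mapping.lookup f m) i) (coeff (Poly_Mapping.lookup g (- m)) i))))"

definition aff_elem :: "'h poly \<Rightarrow> int \<Rightarrow> 'h::ab_group_add affine" where
  "aff_elem a n = (Poly_Mapping.single n a, 0)"

definition aff_nonneg :: "'h::ab_group_add affine set" where
  "aff_nonneg = {(f, c). \<forall>m < 0. Poly_Mapping.lookup f m = 0}"

text \<open>The one-dimensional representation of \<open>aff_nonneg\<close> of level \<open>l\<close>.\<close>

definition vac_rep :: "complex \<Rightarrow> 'h::ab_group_add affine \<Rightarrow> complex \<Rightarrow> complex" where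
  "vac_rep l = (\<lambda>(f, c) b. l * c * b)"

type_synonym 'h fock = "('h affine, complex) ind"

context
  fixes scale :: "complex \<Rightarrow> 'h::ab_group_add \<Rightarrow> 'h"
    and form :: "'h \<Rightarrow> 'h \<Rightarrow> complex"
    and l :: complex
begin

definition heis_module :: "(complex, 'h fock) module" where
  "heis_module = ind_module (aff_scale scale) (aff_bracket form) aff_nonneg (*) (vac_rep l)"

text \<open>The operator \<open>a(n)\<close>.\<close>

definition mode :: "'h poly \<Rightarrow> int \<Rightarrow> 'h fock \<Rightarrow> 'h fock" where
  "mode a n =
     ind_act (aff_scale scale) (aff_bracket form) aff_nonneg (*) (vac_rep l)
       (env_class (aff_scale scale) (aff_bracket form) (gen (aff_elem a n)))"

text \<open>Modes whose indices are both negative, or both nonnegative, commute.\<close>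

definition normal_ordered :: "'h poly \<Rightarrow> int \<Rightarrow> 'h poly \<Rightarrow> int \<Rightarrow> 'h fock \<Rightarrow> 'h fock" where
  "normal_ordered a p b q v =
     (if p \<ge> 0 \<and> q < 0 then mode b q (mode a p v) else mode a p (mode b q v))"

text \<open>
  \<open>finsum\<close> requires a finite index set, so the sum is taken over its nonzero terms. There are
  finitely many of them for \<open>n \<ge> -1\<close>; for \<open>n < -1\<close> the operator \<open>vir_op u d n\<close> is meaningless.
\<close>

definition vir_op :: "(nat \<Rightarrow> 'h) \<Rightarrow> nat \<Rightarrow> int \<Rightarrow> 'h fock \<Rightarrow> 'h fock" where
  "vir_op u d n v =
     (let term = (\<lambda>(i, j, m). normal_ordered (Polynomial.monom (u i) j) (n - m)
                                             (Polynomial.monom (u i) j) m v)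
      in (1 / (2 * l)) \<odot>\<^bsub>heis_module\<^esub>
           finsum heis_module term {s \<in> {1..d} \<times> (UNIV :: nat set) \<times> (UNIV :: int set).
                            term s \<noteq> \<zero>\<^bsub>heis_module\<^esub>})"

end

end

theory Submission
  imports Defs
begin

text \<open>
  Since \<open>n \<ge> -1\<close>, in every term of \<open>L(n)\<close> the larger of the two indices is nonnegative, so the normally
  ordered product is the one with the larger index on the right, and only finitely many terms
  act nontrivially on a given vector. Commuting with one mode gives
  \<open>[L(m), a(r)] = -r a(m + r)\<close>. Applied to both factors of a term \<open>T\<^sub>k\<close> of \<open>L(n)\<close>, where \<open>T\<^sub>k\<close> is the
  ordered product of the modes \<open>n - k\<close> and \<open>k\<close>, this yields the terms \<open>k\<close> and \<open>k + m\<close> of \<open>L(m + n)\<close>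
  with coefficients \<open>k - n\<close> and \<open>-k\<close>. For \<open>m, n \<ge> -1\<close> they come out correctly ordered up to commuting
  modes, which is why no central term appears. Shifting the index in the second family gives
  the factor \<open>(k - n) - (k - m) = m - n\<close>.

  The induced module is generated by its pure tensors \<open>1 \<otimes> b\<close>. A property preserved by linear
  combinations and by the operators of single Lie algebra elements therefore only has to be checked there: this gives both that the
  central element acts as \<open>l\<close> and that almost all nonnegative modes annihilate a given vector.
\<close>

section \<open>Virasoro operators of a system of oscillators\<close>

context abelian_group
begin

text \<open>The sum in \<open>vir_op\<close> has this shape: dropping zero terms turns a family of
  finite support on an infinite index set into a finite sum.\<close>

definition gsum :: "('i \<Rightarrow> 'a) \<Rightarrow> 'i set \<Rightarrow> 'a" where
  "gsum f I = finsum G f {x \<in> I. f x \<noteq> \<zero>}"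

lemma gsum_eq_finsum:
  assumes "finite K" "K \<subseteq> I" "f \<in> I \<rightarrow> carrier G" "\<And>x. x \<in> I - K \<Longrightarrow> f x = \<zero>"
  shows "gsum f I = finsum G f K"
  unfolding gsum_def
  by (rule add.finprod_mono_neutral_cong_left) (use assms in auto)

lemma gsum_closed [intro, simp]:
  "f \<in> I \<rightarrow> carrier G \<Longrightarrow> gsum f I \<in> carrier G"
  unfolding gsum_def by (rule finsum_closed) auto

lemma gsum_cong:
  assumes "\<And>x. x \<in> I \<Longrightarrow> f x = g x" "g \<in> I \<rightarrow> carrier G"
  shows "gsum f I = gsum g I"
  unfolding gsum_def by (rule add.finprod_cong') (use assms in auto)

lemma gsum_add:
  assumes "f \<in> I \<rightarrow> carrier G" "g \<in> I \<rightarrow> carrier G"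
    and "finite {x \<in> I. f x \<noteq> \<zero>}" "finite {x \<in> I. g x \<noteq> \<zero>}"
  shows "gsum (\<lambda>x. f x \<oplus> g x) I = gsum f I \<oplus> gsum g I"
proof -
  let ?K = "{x \<in> I. f x \<noteq> \<zero>} \<union> {x \<in> I. g x \<noteq> \<zero>}"
  have "gsum (\<lambda>x. f x \<oplus> g x) I = finsum G (\<lambda>x. f x \<oplus> g x) ?K"
    by (rule gsum_eq_finsum) (use assms in auto)
  also have "\<dots> = finsum G f ?K \<oplus> finsum G g ?K"
    by (rule finsum_addf) (use assms in auto)
  also have "finsum G f ?K = gsum f I"
    by (rule gsum_eq_finsum [symmetric]) (use assms in auto)
  also have "finsum G g ?K = gsum g I"
    by (rule gsum_eq_finsum [symmetric]) (use assms in auto)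
  finally show ?thesis .
qed

lemma gsum_single:
  assumes "a \<in> I" "w \<in> carrier G"
  shows "gsum (\<lambda>x. if x = a then w else \<zero>) I = w"
proof -
  have "gsum (\<lambda>x. if x = a then w else \<zero>) I = finsum G (\<lambda>x. if x = a then w else \<zero>) {a}"
    by (rule gsum_eq_finsum) (use assms in auto)
  also have "\<dots> = w"
    using assms by (subst finsum_insert) auto
  finally show ?thesis .
qed

lemma gsum_reindex:
  assumes "bij_betw p J I" "f \<in> I \<rightarrow> carrier G"
  shows "gsum (\<lambda>x. f (p x)) J = gsum f I"
proof -
  have img: "p ` {x \<in> J. f (p x) \<noteq> \<zero>} = {x \<in> I. f x \<noteq> \<zero>}"
    using bij_betw_imp_surj_on [OF assms(1)] by auto
  have "inj_on p {x \<in> J. f (p x) \<noteq> \<zero>}"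
    using bij_betw_imp_inj_on [OF assms(1)] by (rule inj_on_subset) auto
  with assms(2) show ?thesis
    unfolding gsum_def img [symmetric]
    by (subst add.finprod_reindex) (use bij_betwE [OF assms(1)] in \<open>auto simp: Pi_iff\<close>)
qed

text \<open>An additive map fixes \<open>\<zero>\<close>, so the support cannot grow and finite
  additivity suffices. This moves modes and Virasoro operators inside the sum that defines another
  Virasoro operator.\<close>

lemma gsum_hom:
  assumes closed: "\<And>x. x \<in> carrier G \<Longrightarrow> h x \<in> carrier G"
    and add: "\<And>x y. x \<in> carrier G \<Longrightarrow> y \<in> carrier G \<Longrightarrow> h (x \<oplus> y) = h x \<oplus> h y"
    and f: "f \<in> I \<rightarrow> carrier G" "finite {x \<in> I. f x \<noteq> \<zero>}"
  shows "h (gsum f I) = gsum (\<lambda>x. h (f x)) I"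
proof -
  have zero: "h \<zero> = \<zero>"
    using add [of \<zero> \<zero>] closed [of \<zero>] by (simp add: add.r_cancel_one')
  have *: "h (finsum G f K) = finsum G (\<lambda>x. h (f x)) K" if "finite K" "f \<in> K \<rightarrow> carrier G" for K
    using that by (induction K) (auto simp: zero add closed Pi_iff)
  have "h (gsum f I) = finsum G (\<lambda>x. h (f x)) {x \<in> I. f x \<noteq> \<zero>}"
    unfolding gsum_def using f by (intro *) auto
  also have "\<dots> = gsum (\<lambda>x. h (f x)) I"
    by (rule gsum_eq_finsum [symmetric]) (use f closed zero in auto)
  finally show ?thesis .
qed

end

section \<open>Complex modules carrying oscillators\<close>

locale complex_module = abelian_group M for M :: "(complex, 'v, 'm) module_scheme" (structure) +
  assumes smult_closed [simp, intro]: "x \<in> carrier M \<Longrightarrow> c \<odot> x \<in> carrier M"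
    and smult_r_distr: "x \<in> carrier M \<Longrightarrow> y \<in> carrier M \<Longrightarrow> c \<odot> (x \<oplus> y) = c \<odot> x \<oplus> c \<odot> y"
    and smult_l_distr: "x \<in> carrier M \<Longrightarrow> (b + c) \<odot> x = b \<odot> x \<oplus> c \<odot> x"
    and smult_assoc: "x \<in> carrier M \<Longrightarrow> (b * c) \<odot> x = b \<odot> (c \<odot> x)"
    and smult_one [simp]: "x \<in> carrier M \<Longrightarrow> 1 \<odot> x = x"
begin

lemma smult_zero_left [simp]: "x \<in> carrier M \<Longrightarrow> 0 \<odot> x = \<zero>"
  using smult_l_distr [of x 0 0] by (simp add: add.r_cancel_one')

lemma smult_zero_right [simp]: "c \<odot> \<zero> = \<zero>"
  using smult_r_distr [of \<zero> \<zero> c] by (simp add: add.r_cancel_one')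

end

text \<open>Abstracts the modes of an orthonormal family: \<open>A_commute\<close> is the Heisenberg
  relation at level \<open>l\<close>, and \<open>A_finite\<close> is what makes the sums for the
  Virasoro operators finite.\<close>

locale oscillators = complex_module M for M :: "(complex, 'v, 'm) module_scheme" (structure) +
  fixes S :: "'s set" and A :: "'s \<Rightarrow> int \<Rightarrow> 'v \<Rightarrow> 'v" and l :: complex
  assumes A_closed [simp, intro]: "s \<in> S \<Longrightarrow> v \<in> carrier M \<Longrightarrow> A s n v \<in> carrier M"
    and A_add: "s \<in> S \<Longrightarrow> v \<in> carrier M \<Longrightarrow> w \<in> carrier M \<Longrightarrow> A s n (v \<oplus> w) = A s n v \<oplus> A s n w"
    and A_smult: "s \<in> S \<Longrightarrow> v \<in> carrier M \<Longrightarrow> A s n (c \<odot> v) = c \<odot> A s n v"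
    and A_commute: "s \<in> S \<Longrightarrow> t \<in> S \<Longrightarrow> v \<in> carrier M \<Longrightarrow>
      A s m (A t n v) = A t n (A s m v) \<oplus> (if s = t \<and> m + n = 0 then l * of_int m else 0) \<odot> v"
    and A_finite: "v \<in> carrier M \<Longrightarrow> finite {(s, n). s \<in> S \<and> 0 \<le> n \<and> A s n v \<noteq> \<zero>}"
    and l_nonzero: "l \<noteq> 0"
begin

text \<open>The use of \<open>min\<close> and \<open>max\<close> makes the term invariant under
  exchanging \<open>k\<close> and \<open>n - k\<close>; the mode of larger index acts first.\<close>

definition ordered :: "int \<Rightarrow> 's \<Rightarrow> int \<Rightarrow> 'v \<Rightarrow> 'v" where
  "ordered n s k v = A s (min k (n - k)) (A s (max k (n - k)) v)"

definition vir :: "int \<Rightarrow> 'v \<Rightarrow> 'v" where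
  "vir n v = (1 / (2 * l)) \<odot> gsum (\<lambda>(s, k). ordered n s k v) (S \<times> UNIV)"

lemma A_zero [simp]: "s \<in> S \<Longrightarrow> A s n \<zero> = \<zero>"
  using A_add [of s \<zero> \<zero> n] by (simp add: add.r_cancel_one')

lemma ordered_closed [simp, intro]:
  "s \<in> S \<Longrightarrow> v \<in> carrier M \<Longrightarrow> ordered n s k v \<in> carrier M"
  by (simp add: ordered_def)

lemma ordered_closed' [simp, intro]:
  "v \<in> carrier M \<Longrightarrow> (\<lambda>(s, k). ordered n s k v) \<in> S \<times> UNIV \<rightarrow> carrier M"
  by auto

lemma vir_closed [simp, intro]: "v \<in> carrier M \<Longrightarrow> vir n v \<in> carrier M"
  by (simp add: vir_def)

text \<open>Two negative indices would sum to at most -2, so for \<open>n \<ge> -1\<close> the mode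
  that acts first has a nonnegative index and \<open>A_finite\<close> applies. That index is
  \<open>k\<close> or \<open>n - k\<close>, so \<open>?F\<close> and its reflection cover the
  support.\<close>

lemma ordered_finite:
  assumes "v \<in> carrier M" "n \<ge> -1"
  shows "finite {x \<in> S \<times> UNIV. (case x of (s, k) \<Rightarrow> ordered n s k v) \<noteq> \<zero>}"
proof -
  let ?F = "{(s, n). s \<in> S \<and> 0 \<le> n \<and> A s n v \<noteq> \<zero>}"
  have "{x \<in> S \<times> UNIV. (case x of (s, k) \<Rightarrow> ordered n s k v) \<noteq> \<zero>}
          \<subseteq> ?F \<union> (\<lambda>(s, p). (s, n - p)) ` ?F"
  proof
    fix x assume "x \<in> {x \<in> S \<times> UNIV. (case x of (s, k) \<Rightarrow> ordered n s k v) \<noteq> \<zero>}"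
    then obtain s k where x: "x = (s, k)" and s: "s \<in> S" and nz: "ordered n s k v \<noteq> \<zero>"
      by auto
    have "A s (max k (n - k)) v \<noteq> \<zero>"
      using nz s by (auto simp: ordered_def)
    moreover have "0 \<le> max k (n - k)"
      using assms(2) by linarith
    ultimately have mem: "(s, max k (n - k)) \<in> ?F"
      using s by auto
    show "x \<in> ?F \<union> (\<lambda>(s, p). (s, n - p)) ` ?F"
    proof (cases "k \<le> n - k")
      case True
      then have "(s, n - k) \<in> ?F" using mem by (simp add: max_def)
      moreover have "x = (\<lambda>(s, p). (s, n - p)) (s, n - k)" by (simp add: x)
      ultimately show ?thesis by blast
    next
      case False
      then show ?thesis using mem unfolding x by (simp add: max_def)
    qed
  qed
  then show ?thesis
    using A_finite [OF assms(1)] by (meson finite_UnI finite_imageI finite_subset)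
qed

lemma ordered_add:
  "s \<in> S \<Longrightarrow> v \<in> carrier M \<Longrightarrow> w \<in> carrier M \<Longrightarrow>
     ordered n s k (v \<oplus> w) = ordered n s k v \<oplus> ordered n s k w"
  by (simp add: ordered_def A_add)

lemma ordered_smult:
  "s \<in> S \<Longrightarrow> v \<in> carrier M \<Longrightarrow> ordered n s k (c \<odot> v) = c \<odot> ordered n s k v"
  by (simp add: ordered_def A_smult)

lemma gsum_smult:
  assumes "f \<in> I \<rightarrow> carrier M" "finite {x \<in> I. f x \<noteq> \<zero>}"
  shows "c \<odot> gsum f I = gsum (\<lambda>x. c \<odot> f x) I"
  by (rule gsum_hom) (use assms in \<open>auto simp: smult_r_distr\<close>)

lemma vir_add:
  assumes "v \<in> carrier M" "w \<in> carrier M" "n \<ge> -1"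
  shows "vir n (v \<oplus> w) = vir n v \<oplus> vir n w"
proof -
  have "gsum (\<lambda>(s, k). ordered n s k (v \<oplus> w)) (S \<times> UNIV)
      = gsum (\<lambda>x. (case x of (s, k) \<Rightarrow> ordered n s k v) \<oplus> (case x of (s, k) \<Rightarrow> ordered n s k w))
          (S \<times> UNIV)"
    by (rule gsum_cong) (use assms in \<open>auto simp: ordered_add\<close>)
  also have "\<dots> = gsum (\<lambda>(s, k). ordered n s k v) (S \<times> UNIV)
      \<oplus> gsum (\<lambda>(s, k). ordered n s k w) (S \<times> UNIV)"
    by (rule gsum_add) (use assms in \<open>auto intro!: ordered_finite\<close>)
  finally show ?thesis
    using assms by (simp add: vir_def smult_r_distr)
qed

lemma vir_smult:
  assumes "v \<in> carrier M" "n \<ge> -1"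
  shows "vir n (c \<odot> v) = c \<odot> vir n v"
proof -
  have "gsum (\<lambda>(s, k). ordered n s k (c \<odot> v)) (S \<times> UNIV)
      = gsum (\<lambda>x. c \<odot> (case x of (s, k) \<Rightarrow> ordered n s k v)) (S \<times> UNIV)"
    by (rule gsum_cong) (use assms in \<open>auto simp: ordered_smult\<close>)
  also have "\<dots> = c \<odot> gsum (\<lambda>(s, k). ordered n s k v) (S \<times> UNIV)"
    by (rule gsum_smult [symmetric]) (use assms in \<open>auto intro!: ordered_finite\<close>)
  finally show ?thesis
    using assms by (simp add: vir_def smult_assoc [symmetric] mult.commute)
qed

text \<open>Two modes of one oscillator can fail to commute only if their indices sum to zero, so
  only then does the order matter. The symmetry of \<open>ordered\<close> lets either index serve as
  the label \<open>k\<close>.\<close>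

lemma A_A_eq_ordered:
  assumes s: "s \<in> S" and v: "v \<in> carrier M" and ab: "a \<le> b \<or> a + b \<noteq> 0"
    and n: "n = a + b" and k: "k = a \<or> k = b"
  shows "A s a (A s b v) = ordered n s k v"
proof (cases "a \<le> b")
  case True
  then show ?thesis using n k by (auto simp: ordered_def min_def max_def)
next
  case False
  then have "A s a (A s b v) = A s b (A s a v)"
    using A_commute [OF s s v, of a b] ab s v by simp
  with False show ?thesis using n k by (auto simp: ordered_def min_def max_def)
qed

text \<open>Moving \<open>A s r\<close> to the left past both factors leaves a central term for each
  factor of index \<open>- r\<close>; the other factor then has index \<open>m + r\<close>. The
  label \<open>k\<close> of such a term is \<open>- r\<close> or \<open>m + r\<close>, and both
  corrections apply if these coincide.\<close>

lemma ordered_A: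
  assumes s: "s \<in> S" and t: "t \<in> S" and v: "v \<in> carrier M"
  shows "ordered m t k (A s r v) = A s r (ordered m t k v)
     \<oplus> ((if (t, k) = (s, - r) then (- l * of_int r) \<odot> A s (m + r) v else \<zero>)
     \<oplus> (if (t, k) = (s, m + r) then (- l * of_int r) \<odot> A s (m + r) v else \<zero>))"
proof -
  let ?w = "(- l * of_int r) \<odot> A s (m + r) v"
  have w: "?w \<in> carrier M" using s v by simp
  \<comment> \<open>Stated for any split of \<open>m\<close>, so that both orders of the pair are
    instances; in one of them the two corrections trade places.\<close>
  have key: "A t p (A t q (A s r v)) = A s r (A t p (A t q v))
      \<oplus> ((if t = s \<and> p = - r then ?w else \<zero>) \<oplus> (if t = s \<and> q = - r then ?w else \<zero>))"
    if pq: "m = p + q" for p q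
  proof -
    let ?c = "if t = s \<and> q + r = 0 then l * of_int q else 0"
    let ?e = "if t = s \<and> p + r = 0 then l * of_int p else 0"
    have "A t p (A t q (A s r v)) = A t p (A s r (A t q v)) \<oplus> ?c \<odot> A t p v"
      using s t v A_commute [OF t s v, of q r] by (simp only: A_add A_smult A_closed smult_closed)
    also have "A t p (A s r (A t q v)) = A s r (A t p (A t q v)) \<oplus> ?e \<odot> A t q v"
      by (rule A_commute) (use s t v in auto)
    also have "?e \<odot> A t q v = (if t = s \<and> p = - r then ?w else \<zero>)"
    proof (cases "t = s \<and> p = - r")
      case True
      with pq show ?thesis by auto
    next
      case False
      then have "\<not> (t = s \<and> p + r = 0)" by auto
      with False show ?thesis using t v by auto
    qed
    also have "?c \<odot> A t p v = (if t = s \<and> q = - r then ?w else \<zero>)"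
    proof (cases "t = s \<and> q = - r")
      case True
      with pq show ?thesis by auto
    next
      case False
      then have "\<not> (t = s \<and> q + r = 0)" by auto
      with False show ?thesis using t v by auto
    qed
    finally show ?thesis
      using s t v w by (simp add: a_assoc)
  qed
  show ?thesis
  proof (cases "k \<le> m - k")
    case True
    then show ?thesis
      using key [of k "m - k"] by (auto simp: ordered_def)
  next
    case False
    then show ?thesis
      using key [of "m - k" k] w by (auto simp: ordered_def a_comm)
  qed
qed

text \<open>Each correction in \<open>ordered_A\<close> is supported at a single label, so together
  they sum to \<open>- 2 * l * r\<close> times the mode, and the prefactor
  \<open>1 / (2 * l)\<close> leaves \<open>- r\<close>.\<close>

lemma vir_A:
  assumes s: "s \<in> S" and v: "v \<in> carrier M" and m: "m \<ge> -1"
  shows "vir m (A s r v) = A s r (vir m v) \<oplus> of_int (- r) \<odot> A s (m + r) v"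
proof -
  let ?I = "S \<times> (UNIV :: int set)"
  let ?w = "(- l * of_int r) \<odot> A s (m + r) v"
  let ?f = "\<lambda>x. A s r (case x of (t, k) \<Rightarrow> ordered m t k v)"
  let ?g = "\<lambda>x. if x = (s, - r) then ?w else \<zero>"
  let ?h = "\<lambda>x. if x = (s, m + r) then ?w else \<zero>"
  have w: "?w \<in> carrier M" using s v by simp
  have fin: "finite {x \<in> ?I. ?f x \<noteq> \<zero>}"
    by (rule finite_subset [OF _ ordered_finite [OF v m]]) (use s in auto)
  have fg: "finite {x \<in> ?I. ?g x \<noteq> \<zero>}"
    by (rule finite_subset [of _ "{(s, - r)}"]) auto
  have fh: "finite {x \<in> ?I. ?h x \<noteq> \<zero>}"
    by (rule finite_subset [of _ "{(s, m + r)}"]) auto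
  have fgh: "finite {x \<in> ?I. ?g x \<oplus> ?h x \<noteq> \<zero>}"
    by (rule finite_subset [of _ "{(s, - r), (s, m + r)}"]) (auto split: if_splits)
  have cf: "?f \<in> ?I \<rightarrow> carrier M" and cg: "?g \<in> ?I \<rightarrow> carrier M" and ch: "?h \<in> ?I \<rightarrow> carrier M"
    using s v w by auto
  have "gsum (\<lambda>(t, k). ordered m t k (A s r v)) ?I = gsum (\<lambda>x. ?f x \<oplus> (?g x \<oplus> ?h x)) ?I"
  proof (rule gsum_cong)
    fix x assume "x \<in> ?I"
    then show "(case x of (t, k) \<Rightarrow> ordered m t k (A s r v)) = ?f x \<oplus> (?g x \<oplus> ?h x)"
      using ordered_A [OF s _ v] by (cases x) simp
  qed (use s v w in auto)
  also have "\<dots> = gsum ?f ?I \<oplus> (gsum ?g ?I \<oplus> gsum ?h ?I)"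
    using gsum_add [OF cf _ fin fgh] gsum_add [OF cg ch fg fh] cg ch by (simp add: Pi_iff)
  also have "gsum ?g ?I = ?w"
    using s w by (intro gsum_single) auto
  also have "gsum ?h ?I = ?w"
    using s w by (intro gsum_single) auto
  also have "gsum ?f ?I = A s r (gsum (\<lambda>(t, k). ordered m t k v) ?I)"
    by (rule gsum_hom [symmetric]) (use s v m in \<open>auto simp: A_add intro!: ordered_finite\<close>)
  also have "?w \<oplus> ?w = (- 2 * l * of_int r) \<odot> A s (m + r) v"
    using s v by (simp flip: smult_l_distr add: algebra_simps)
  finally have "vir m (A s r v) = (1 / (2 * l)) \<odot> A s r (gsum (\<lambda>(t, k). ordered m t k v) ?I)
      \<oplus> (1 / (2 * l)) \<odot> ((- 2 * l * of_int r) \<odot> A s (m + r) v)"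
    using s v by (simp add: vir_def smult_r_distr)
  also have "(1 / (2 * l)) \<odot> ((- 2 * l * of_int r) \<odot> A s (m + r) v) = of_int (- r) \<odot> A s (m + r) v"
    using s v l_nonzero by (simp flip: smult_assoc)
  finally show ?thesis
    using s v by (simp add: vir_def A_smult)
qed

text \<open>The commutator with \<open>vir m\<close> is a derivation, so \<open>vir_A\<close>
  applies to one factor at a time. Hitting the factor \<open>n - k\<close> keeps the index
  \<open>k\<close>, hitting the factor \<open>k\<close> raises it to \<open>k + m\<close>; this
  gives the two labels.\<close>

lemma vir_ordered:
  assumes s: "s \<in> S" and v: "v \<in> carrier M" and m: "m \<ge> -1" and n: "n \<ge> -1"
  shows "vir m (ordered n s k v) = ordered n s k (vir m v)
     \<oplus> (of_int (k - n) \<odot> ordered (m + n) s k v \<oplus> of_int (- k) \<odot> ordered (m + n) s (k + m) v)"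
proof -
  have key: "vir m (A s p (A s q v)) = A s p (A s q (vir m v))
      \<oplus> (of_int (- q) \<odot> A s p (A s (m + q) v) \<oplus> of_int (- p) \<odot> A s (m + p) (A s q v))" for p q
    using s v m by (simp add: vir_A A_add A_smult a_assoc)
  show ?thesis
  proof (cases "k \<le> n - k")
    case True
    \<comment> \<open>With \<open>m = - n\<close> this says \<open>m + k \<le> n - k\<close>, the
      order required of the second product. For \<open>n = -1\<close> integrality is essential:
      \<open>2 * k \<le> -1\<close> gives \<open>k \<le> -1\<close>.\<close>
    then have le: "k \<le> n" if "m + n = 0" using m n that by presburger
    have "A s k (A s (m + (n - k)) v) = ordered (m + n) s k v"
      by (rule A_A_eq_ordered) (use s v True m n le in auto)
    moreover have "A s (m + k) (A s (n - k) v) = ordered (m + n) s (k + m) v"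
      by (rule A_A_eq_ordered) (use s v True le in auto)
    ultimately show ?thesis
      using True key [of k "n - k"] by (simp add: ordered_def)
  next
    case False
    have "A s (n - k) (A s (m + k) v) = ordered (m + n) s (k + m) v"
      by (rule A_A_eq_ordered) (use s v False m n in auto)
    moreover have "A s (m + (n - k)) (A s k v) = ordered (m + n) s k v"
      by (rule A_A_eq_ordered) (use s v False m n in auto)
    ultimately show ?thesis
      using False key [of "n - k" k] s v by (simp add: ordered_def a_comm)
  qed
qed

text \<open>The bound on \<open>m + n\<close> supplies the finite support of the sum for
  \<open>vir (m + n)\<close>; under the other two bounds it excludes only
  \<open>m = n = -1\<close>.\<close>

lemma vir_vir:
  assumes v: "v \<in> carrier M" and m: "m \<ge> -1" and n: "n \<ge> -1" and mn: "m + n \<ge> -1"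
  shows "vir m (vir n v) = vir n (vir m v) \<oplus> of_int (m - n) \<odot> vir (m + n) v"
proof -
  let ?I = "S \<times> (UNIV :: int set)"
  let ?T = "\<lambda>n v x. case x of (s, k) \<Rightarrow> ordered n s k v"
  let ?g = "\<lambda>x. of_int (snd x - n) \<odot> ?T (m + n) v x"
  \<comment> \<open>The second family of \<open>vir_ordered\<close> is \<open>?h\<close> composed
    with the shift \<open>?p\<close>: at \<open>k + m\<close> the coefficient is
    \<open>m - (k + m) = - k\<close>. At a common label the coefficients of \<open>?g\<close> and
    \<open>?h\<close> add up to \<open>m - n\<close>.\<close>
  let ?h = "\<lambda>x. of_int (m - snd x) \<odot> ?T (m + n) v x"
  let ?p = "\<lambda>(s, k). (s, k + m)"
  have bij: "bij_betw ?p ?I ?I"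
    by (rule bij_betwI [of _ _ _ "\<lambda>(s, k). (s, k - m)"]) auto
  have cf: "?T n (vir m v) \<in> ?I \<rightarrow> carrier M" and cg: "?g \<in> ?I \<rightarrow> carrier M"
    and ch: "?h \<in> ?I \<rightarrow> carrier M"
    using v by auto
  have ff: "finite {x \<in> ?I. ?T n (vir m v) x \<noteq> \<zero>}"
    using v n by (intro ordered_finite) auto
  have fg: "finite {x \<in> ?I. ?g x \<noteq> \<zero>}"
    by (rule finite_subset [OF _ ordered_finite [OF v mn]]) auto
  have fh: "finite {x \<in> ?I. ?h x \<noteq> \<zero>}"
    by (rule finite_subset [OF _ ordered_finite [OF v mn]]) auto
  have "finite (?p -` {x \<in> ?I. ?h x \<noteq> \<zero>} \<inter> ?I)"
    using fh bij by (intro finite_vimage_IntI) (auto dest: bij_betw_imp_inj_on)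
  then have fhp: "finite {x \<in> ?I. ?h (?p x) \<noteq> \<zero>}"
    by (rule finite_subset [rotated]) auto
  have chp: "(\<lambda>x. ?h (?p x)) \<in> ?I \<rightarrow> carrier M"
    using v by auto
  have fghp: "finite {x \<in> ?I. ?g x \<oplus> ?h (?p x) \<noteq> \<zero>}"
    by (rule finite_subset [OF _ finite_UnI [OF fg fhp]]) (use v in auto)
  have "vir m (gsum (?T n v) ?I) = gsum (\<lambda>x. vir m (?T n v x)) ?I"
    by (rule gsum_hom) (use v m n in \<open>auto simp: vir_add intro!: ordered_finite\<close>)
  also have "\<dots> = gsum (\<lambda>x. ?T n (vir m v) x \<oplus> (?g x \<oplus> ?h (?p x))) ?I"
    by (rule gsum_cong) (use v m n in \<open>auto simp: vir_ordered\<close>)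
  also have "\<dots> = gsum (?T n (vir m v)) ?I \<oplus> (gsum ?g ?I \<oplus> gsum (\<lambda>x. ?h (?p x)) ?I)"
    using gsum_add [OF cf _ ff fghp] gsum_add [OF cg chp fg fhp] cg chp by (simp add: Pi_iff)
  also have "gsum (\<lambda>x. ?h (?p x)) ?I = gsum ?h ?I"
    by (rule gsum_reindex [OF bij ch])
  also have "gsum ?g ?I \<oplus> gsum ?h ?I = gsum (\<lambda>x. ?g x \<oplus> ?h x) ?I"
    by (rule gsum_add [OF cg ch fg fh, symmetric])
  also have "\<dots> = gsum (\<lambda>x. of_int (m - n) \<odot> ?T (m + n) v x) ?I"
    by (rule gsum_cong) (use v in \<open>auto simp flip: smult_l_distr\<close>)
  also have "\<dots> = of_int (m - n) \<odot> gsum (?T (m + n) v) ?I"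
    by (rule gsum_smult [symmetric]) (use v mn in \<open>auto intro!: ordered_finite\<close>)
  finally have "(1 / (2 * l)) \<odot> vir m (gsum (?T n v) ?I) = vir n (vir m v)
      \<oplus> of_int (m - n) \<odot> vir (m + n) v"
    using v by (simp add: vir_def smult_r_distr mult.commute flip: smult_assoc)
  moreover have "vir m (vir n v) = (1 / (2 * l)) \<odot> vir m (gsum (?T n v) ?I)"
    unfolding vir_def [of n v] using v m by (intro vir_smult) auto
  ultimately show ?thesis by simp
qed

text \<open>Beyond \<open>vir_vir\<close> only \<open>m = n = -1\<close> is left. There the left
  side is a difference of equal elements and the scalar on the right is zero, while
  \<open>vir (-2) v\<close> still lies in the carrier.\<close>

theorem vir_commutator:
  assumes v: "v \<in> carrier M" and m: "m \<ge> -1" and n: "n \<ge> -1"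
  shows "vir m (vir n v) \<ominus> vir n (vir m v) = of_int (m - n) \<odot> vir (m + n) v"
proof (cases "m + n \<ge> -1")
  case True
  then show ?thesis
    using assms vir_vir [of v m n] by (simp add: minus_eq a_comm [of "vir n (vir m v)"] a_assoc r_neg)
next
  case False
  then have "m = n" using m n by simp
  then show ?thesis using v by (simp add: minus_eq r_neg)
qed

end

section \<open>Free algebras and enveloping algebras\<close>

lemma poly_mapping_induct_single [consumes 1, case_names zero single add]:
  assumes "Poly_Mapping.keys f \<subseteq> S"
    and zero: "P 0"
    and single: "\<And>w c. w \<in> S \<Longrightarrow> P (Poly_Mapping.single w c)"
    and add: "\<And>f g. Poly_Mapping.keys f \<subseteq> S \<Longrightarrow> Poly_Mapping.keys g \<subseteq> S \<Longrightarrow> P f \<Longrightarrow> P g \<Longrightarrow> P (f + g)"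
  shows "P (f :: 'k \<Rightarrow>\<^sub>0 'c::monoid_add)"
  using assms(1)
proof (induction f rule: update_induct)
  case const
  show ?case by (rule zero)
next
  case (update f a b)
  \<comment> \<open>The key \<open>a\<close> is new, so overwriting its value amounts to adding a
    single term.\<close>
  have "Poly_Mapping.update a b f = f + Poly_Mapping.single a b"
    using update.hyps
    by (intro poly_mapping_eqI)
      (auto simp: lookup_update lookup_add lookup_single when_def in_keys_iff)
  moreover have "Poly_Mapping.keys f \<subseteq> S" "a \<in> S"
    using update.prems update.hyps by (auto simp: keys_update)
  ultimately show ?case
    using update.IH by (auto intro!: add single split: if_splits)
qed

section \<open>The free algebra on a subset as a ring\<close>

lemma free_algebra_sel [simp]:
  "f \<in> carrier (free_algebra P) \<longleftrightarrow> (\<forall>w \<in> Poly_Mapping.keys f. set (letters w) \<subseteq> P)"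
  "monoid.mult (free_algebra P) = (*)"
  "monoid.one (free_algebra P) = 1"
  "ring.zero (free_algebra P) = 0"
  "ring.add (free_algebra P) = (+)"
  by (auto simp: free_algebra_def)

lemma free_algebra_UNIV [simp]: "carrier (free_algebra UNIV) = UNIV"
  by (auto simp: free_algebra_def)

lemma letters_zero [simp]: "letters 0 = []"
  by (simp add: zero_word_def)

lemma letters_add [simp]: "letters (v + w) = letters v @ letters w"
  by (simp add: plus_word_def)

lemma free_add_closed:
  "f \<in> carrier (free_algebra P) \<Longrightarrow> g \<in> carrier (free_algebra P) \<Longrightarrow> f + g \<in> carrier (free_algebra P)"
  using keys_add [of f g] by auto

lemma free_diff_closed:
  "f \<in> carrier (free_algebra P) \<Longrightarrow> g \<in> carrier (free_algebra P) \<Longrightarrow> f - g \<in> carrier (free_algebra P)"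
  using free_add_closed [of f P "- g"] by simp

lemma free_mult_closed:
  "f \<in> carrier (free_algebra P) \<Longrightarrow> g \<in> carrier (free_algebra P) \<Longrightarrow> f * g \<in> carrier (free_algebra P)"
  using keys_mult [of f g] by fastforce

lemma ring_free_algebra: "ring (free_algebra P)"
proof (rule ringI)
  show "abelian_group (free_algebra P)"
  proof (rule abelian_groupI)
    fix f assume "f \<in> carrier (free_algebra P)"
    then show "\<exists>g \<in> carrier (free_algebra P). g \<oplus>\<^bsub>free_algebra P\<^esub> f = \<zero>\<^bsub>free_algebra P\<^esub>"
      by (intro bexI [of _ "- f"]) auto
  next
    fix f g assume "f \<in> carrier (free_algebra P)" "g \<in> carrier (free_algebra P)"
    then show "f \<oplus>\<^bsub>free_algebra P\<^esub> g \<in> carrier (free_algebra P)"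
      by (simp add: free_add_closed del: free_algebra_sel(1))
  qed (auto simp: add_ac)
  show "monoid (free_algebra P)"
  proof (rule monoidI)
    fix f g assume "f \<in> carrier (free_algebra P)" "g \<in> carrier (free_algebra P)"
    then show "f \<otimes>\<^bsub>free_algebra P\<^esub> g \<in> carrier (free_algebra P)"
      by (simp add: free_mult_closed del: free_algebra_sel(1))
  qed (auto simp: mult.assoc)
qed (auto simp: algebra_simps)

lemma uminus_free_algebra:
  "f \<in> carrier (free_algebra P) \<Longrightarrow> a_inv (free_algebra P) f = - f"
proof -
  assume f: "f \<in> carrier (free_algebra P)"
  interpret ring "free_algebra P" by (rule ring_free_algebra)
  show ?thesis
    by (rule minus_equality [symmetric, THEN sym]) (use f in auto)
qed

lemma gen_closed: "x \<in> P \<Longrightarrow> gen x \<in> carrier (free_algebra P)"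
  by (simp add: gen_def)

lemma const_closed: "const c \<in> carrier (free_algebra P)"
  by (simp add: const_def)

lemma const_add: "const (b + c) = const b + const c"
  by (simp add: const_def single_add)

lemma const_mult: "const (b * c) = const b * const c"
  by (simp add: const_def mult_single)

lemma const_one: "const 1 = 1"
  by (simp add: const_def)

lemma single_letters:
  "letters w = x # xs \<Longrightarrow> Poly_Mapping.single w c = gen x * Poly_Mapping.single (Word xs) c"
  by (cases w) (simp add: gen_def mult_single plus_word_def)

text \<open>Splitting off the first letter of each word builds every element from scalars by sums
  and left multiplication by generators.\<close>

lemma free_algebra_induct [consumes 1, case_names const add gen]:
  assumes "f \<in> carrier (free_algebra P)"
    and const: "\<And>c. Q (const c)"
    and add: "\<And>f g. Q f \<Longrightarrow> Q g \<Longrightarrow> Q (f + g)"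
    and gen: "\<And>x f. x \<in> P \<Longrightarrow> f \<in> carrier (free_algebra P) \<Longrightarrow> Q f \<Longrightarrow> Q (gen x * f)"
  shows "Q f"
proof -
  have single_word: "Q (Poly_Mapping.single (Word xs) c)" if "set xs \<subseteq> P" for xs c
    using that
  proof (induction xs)
    case Nil
    show ?case using const [of c] by (simp add: const_def zero_word_def)
  next
    case (Cons x xs)
    then show ?case
      using single_letters [of "Word (x # xs)" x xs c] by (auto intro!: gen)
  qed
  have "Poly_Mapping.keys f \<subseteq> {w. set (letters w) \<subseteq> P}"
    using assms(1) by auto
  then show ?thesis
  proof (induction f rule: poly_mapping_induct_single)
    case zero
    then show ?case using const [of 0] by (simp add: const_def)
  next
    case (single w c)
    then show ?case using single_word [of "letters w" c] by (cases w) auto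
  qed (rule add)
qed

text \<open>Centrality of the scalars is what makes the action on the induced module complex linear,
  since scalar multiplication there is itself a left multiplication.\<close>

lemma const_commute: "const c * f = f * const c"
proof -
  have "f \<in> carrier (free_algebra UNIV)" by simp
  then show ?thesis
  proof (induction f rule: free_algebra_induct)
    case (const b)
    show ?case by (simp only: mult.commute [of c b] flip: const_mult)
  next
    case (add f g)
    then show ?case by (simp add: algebra_simps)
  next
    case (gen x f)
    have "const c * (gen x * f) = (gen x * const c) * f"
      by (simp add: const_def gen_def mult_single flip: mult.assoc)
    then show ?case by (simp only: mult.assoc gen.IH)
  qed
qed

section \<open>Enveloping algebras as quotients of free algebras\<close>

lemma ideal_env_ideal_UNIV: "ideal (env_ideal sc br UNIV) (free_algebra UNIV)"
  unfolding env_ideal_def by (rule ring.genideal_ideal [OF ring_free_algebra]) simp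

lemma env_relators_subset_ideal: "env_relators sc br UNIV \<subseteq> env_ideal sc br UNIV"
  unfolding env_ideal_def by (rule ring.genideal_self [OF ring_free_algebra]) simp

lemma ring_env_algebra_UNIV: "ring (env_algebra sc br UNIV)"
  unfolding env_algebra_def by (rule ideal.quotient_is_ring [OF ideal_env_ideal_UNIV])

lemma env_class_hom: "env_class sc br \<in> ring_hom (free_algebra UNIV) (env_algebra sc br UNIV)"
  using ideal.rcos_ring_hom [OF ideal_env_ideal_UNIV, of sc br]
  unfolding env_algebra_def env_class_def .

lemma env_class_closed: "env_class sc br f \<in> carrier (env_algebra sc br UNIV)"
  using env_class_hom by (rule ring_hom_closed) simp

lemma env_class_add: "env_class sc br (f + g) = env_class sc br f \<oplus>\<^bsub>env_algebra sc br UNIV\<^esub> env_class sc br g"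
  using ring_hom_add [OF env_class_hom, of f g] by simp

lemma env_class_mult: "env_class sc br (f * g) = env_class sc br f \<otimes>\<^bsub>env_algebra sc br UNIV\<^esub> env_class sc br g"
  using ring_hom_mult [OF env_class_hom, of f g] by simp

lemma carrier_env_algebra:
  "carrier (env_algebra sc br P)
     = (\<lambda>f. env_ideal sc br P +>\<^bsub>free_algebra P\<^esub> f) ` carrier (free_algebra P)"
  by (simp add: env_algebra_def FactRing_def A_RCOSETS_def' UNION_singleton_eq_range)

lemma env_class_surj: "X \<in> carrier (env_algebra sc br UNIV) \<Longrightarrow> \<exists>f. X = env_class sc br f"
  by (auto simp: carrier_env_algebra env_class_def)

lemma env_class_eqI:
  assumes "f - g \<in> env_ideal sc br UNIV"
  shows "env_class sc br f = env_class sc br g"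
proof -
  interpret ideal "env_ideal sc br UNIV" "free_algebra UNIV" by (rule ideal_env_ideal_UNIV)
  have "f \<in> env_ideal sc br UNIV +>\<^bsub>free_algebra UNIV\<^esub> g"
    using assms by (force simp: a_r_coset_def')
  then show ?thesis
    unfolding env_class_def by (intro a_repr_independence' [symmetric]) auto
qed

text \<open>The conditions on \<open>\<rho>\<close> are confined to \<open>P\<close> because the
  vacuum representation respects brackets on \<open>aff_nonneg\<close>, but in general not on the
  whole affinization.\<close>

locale subrep =
  fixes sc :: "complex \<Rightarrow> 'g::ab_group_add \<Rightarrow> 'g"
    and br :: "'g \<Rightarrow> 'g \<Rightarrow> 'g"
    and P :: "'g set"
    and scw :: "complex \<Rightarrow> 'w::ab_group_add \<Rightarrow> 'w"
    and \<rho> :: "'g \<Rightarrow> 'w \<Rightarrow> 'w"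
  assumes scw: "vector_space scw"
    and P_add: "x \<in> P \<Longrightarrow> y \<in> P \<Longrightarrow> x + y \<in> P"
    and P_sc: "x \<in> P \<Longrightarrow> sc c x \<in> P"
    and P_br: "x \<in> P \<Longrightarrow> y \<in> P \<Longrightarrow> br x y \<in> P"
    and rho_add: "x \<in> P \<Longrightarrow> \<rho> x (b + b') = \<rho> x b + \<rho> x b'"
    and rho_scale: "x \<in> P \<Longrightarrow> \<rho> x (scw c b) = scw c (\<rho> x b)"
    and rho_plus: "x \<in> P \<Longrightarrow> y \<in> P \<Longrightarrow> \<rho> (x + y) b = \<rho> x b + \<rho> y b"
    and rho_sc: "x \<in> P \<Longrightarrow> \<rho> (sc c x) b = scw c (\<rho> x b)"
    and rho_br: "x \<in> P \<Longrightarrow> y \<in> P \<Longrightarrow> \<rho> (br x y) b = \<rho> x (\<rho> y b) - \<rho> y (\<rho> x b)"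
begin

interpretation W: vector_space scw by (rule scw)

lemma env_relators_closed: "env_relators sc br P \<subseteq> carrier (free_algebra P)"
  unfolding env_relators_def
  by (auto simp del: free_algebra_sel(1)
      intro!: free_diff_closed free_mult_closed gen_closed const_closed P_add P_sc P_br)

lemma ideal_env_ideal: "ideal (env_ideal sc br P) (free_algebra P)"
  unfolding env_ideal_def by (rule ring.genideal_ideal [OF ring_free_algebra env_relators_closed])

lemma free_rep_eq:
  assumes "finite K" "Poly_Mapping.keys f \<subseteq> K"
  shows "free_rep scw \<rho> f b = (\<Sum>w\<in>K. scw (Poly_Mapping.lookup f w) (foldr \<rho> (letters w) b))"
  unfolding free_rep_def
  by (rule sum.mono_neutral_left) (use assms in \<open>auto simp: in_keys_iff\<close>)

lemma free_rep_plus: "free_rep scw \<rho> (f + g) b = free_rep scw \<rho> f b + free_rep scw \<rho> g b"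
proof -
  let ?K = "Poly_Mapping.keys f \<union> Poly_Mapping.keys g"
  show ?thesis
    using keys_add [of f g]
    by (simp add: free_rep_eq [of ?K] lookup_add W.scale_left_distrib sum.distrib)
qed

lemma free_rep_zero [simp]: "free_rep scw \<rho> 0 b = 0"
  by (simp add: free_rep_def)

lemma free_rep_minus: "free_rep scw \<rho> (f - g) b = free_rep scw \<rho> f b - free_rep scw \<rho> g b"
  using free_rep_plus [of "f - g" g b] by simp

lemma free_rep_single: "free_rep scw \<rho> (Poly_Mapping.single w c) b = scw c (foldr \<rho> (letters w) b)"
  by (simp add: free_rep_def)

lemma free_rep_const [simp]: "free_rep scw \<rho> (const c) b = scw c b"
  by (simp add: const_def free_rep_single)

lemma free_rep_gen [simp]: "free_rep scw \<rho> (gen x) b = \<rho> x b"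
  by (simp add: gen_def free_rep_single)

lemma foldr_rho_linear:
  assumes "set xs \<subseteq> P"
  shows "foldr \<rho> xs (b + b') = foldr \<rho> xs b + foldr \<rho> xs b'"
    and "foldr \<rho> xs (scw c b) = scw c (foldr \<rho> xs b)"
  using assms by (induction xs) (auto simp: rho_add rho_scale)

lemma free_rep_linear:
  assumes "f \<in> carrier (free_algebra P)"
  shows "free_rep scw \<rho> f (b + b') = free_rep scw \<rho> f b + free_rep scw \<rho> f b'"
    and "free_rep scw \<rho> f (scw c b) = scw c (free_rep scw \<rho> f b)"
  using assms
  by (auto simp: free_rep_def foldr_rho_linear W.scale_right_distrib W.scale_sum_right
      W.scale_left_commute mult.commute simp flip: sum.distrib intro!: sum.cong)

lemma free_rep_gen_mult:
  assumes x: "x \<in> P" and "f \<in> carrier (free_algebra P)"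
  shows "free_rep scw \<rho> (gen x * f) b = \<rho> x (free_rep scw \<rho> f b)"
proof -
  have rho_zero: "\<rho> x 0 = 0"
    using rho_add [OF x, of 0 0] by simp
  have "Poly_Mapping.keys f \<subseteq> UNIV" by simp
  then show ?thesis
  proof (induction f rule: poly_mapping_induct_single)
    case zero
    then show ?case by (simp add: rho_zero)
  next
    case (single w c)
    then show ?case by (simp add: gen_def mult_single free_rep_single rho_scale x)
  next
    case (add f g)
    then show ?case by (simp add: distrib_left free_rep_plus rho_add x)
  qed
qed

lemma free_rep_mult:
  assumes "f \<in> carrier (free_algebra P)" and g: "g \<in> carrier (free_algebra P)"
  shows "free_rep scw \<rho> (f * g) b = free_rep scw \<rho> f (free_rep scw \<rho> g b)"
  using assms(1)
proof (induction f rule: free_algebra_induct)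
  case (const c)
  have "Poly_Mapping.keys g \<subseteq> UNIV" by simp
  then show ?case
  proof (induction g rule: poly_mapping_induct_single)
    case (single w d)
    then show ?case by (simp add: const_def mult_single free_rep_single)
  qed (simp_all add: distrib_left free_rep_plus W.scale_right_distrib)
next
  case (add f f')
  then show ?case by (simp add: distrib_right free_rep_plus)
next
  case (gen x f)
  then show ?case
    using g by (simp add: mult.assoc free_rep_gen_mult free_mult_closed del: free_algebra_sel(1))
qed

text \<open>This is the annihilator of the representation. It is two-sided since products act by
  composition and every element sends zero to zero.\<close>

lemma ideal_kernel:
  "ideal {f \<in> carrier (free_algebra P). \<forall>b. free_rep scw \<rho> f b = 0} (free_algebra P)"
proof (rule idealI [OF ring_free_algebra])
  interpret ring "free_algebra P" by (rule ring_free_algebra)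
  let ?K = "{f \<in> carrier (free_algebra P). \<forall>b. free_rep scw \<rho> f b = 0}"
  have uminus: "free_rep scw \<rho> (- f) b = - free_rep scw \<rho> f b" for f b
    using free_rep_minus [of 0 f b] by simp
  show "subgroup ?K (add_monoid (free_algebra P))"
  proof (rule add.subgroupI)
    fix f assume "f \<in> ?K"
    then show "\<ominus>\<^bsub>free_algebra P\<^esub> f \<in> ?K"
      by (simp add: uminus_free_algebra uminus del: free_algebra_sel(1)) simp
  next
    fix f g assume "f \<in> ?K" "g \<in> ?K"
    then show "f \<oplus>\<^bsub>free_algebra P\<^esub> g \<in> ?K"
      by (simp add: free_rep_plus free_add_closed del: free_algebra_sel(1))
  next
    have "0 \<in> ?K" by simp
    then show "?K \<noteq> {}" by blast
  qed blast
  fix f g assume "f \<in> ?K" "g \<in> carrier (free_algebra P)"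
  moreover have "free_rep scw \<rho> g 0 = 0" if "g \<in> carrier (free_algebra P)" for g
    using free_rep_linear(1) [OF that, of 0 0] by simp
  ultimately show "g \<otimes>\<^bsub>free_algebra P\<^esub> f \<in> ?K" "f \<otimes>\<^bsub>free_algebra P\<^esub> g \<in> ?K"
    by (auto simp add: free_rep_mult free_mult_closed simp del: free_algebra_sel(1))
qed

text \<open>The axioms on \<open>\<rho>\<close> say that the relators act as zero; minimality of the
  generated ideal does the rest.\<close>

lemma env_ideal_subset_kernel:
  "env_ideal sc br P \<subseteq> {f \<in> carrier (free_algebra P). \<forall>b. free_rep scw \<rho> f b = 0}"
  unfolding env_ideal_def
proof (rule ring.genideal_minimal [OF ring_free_algebra ideal_kernel], rule subsetI)
  fix f assume f: "f \<in> env_relators sc br P"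
  then have "free_rep scw \<rho> f b = 0" for b
    unfolding env_relators_def
    by (auto simp: free_rep_minus rho_plus rho_sc rho_br free_rep_mult gen_closed const_closed
        simp del: free_algebra_sel(1))
  then show "f \<in> {f \<in> carrier (free_algebra P). \<forall>b. free_rep scw \<rho> f b = 0}"
    using f env_relators_closed by blast
qed

text \<open>Representatives of a coset differ by an element that acts as zero. Hence the image in
  \<open>env_rep\<close> is a singleton and \<open>the_elem\<close> returns its member.\<close>

lemma env_rep_coset:
  assumes "f \<in> carrier (free_algebra P)"
  shows "env_rep scw \<rho> (env_ideal sc br P +>\<^bsub>free_algebra P\<^esub> f) b = free_rep scw \<rho> f b"
proof -
  interpret ideal "env_ideal sc br P" "free_algebra P" by (rule ideal_env_ideal)
  have "free_rep scw \<rho> g b = free_rep scw \<rho> f b"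
    if g: "g \<in> env_ideal sc br P +>\<^bsub>free_algebra P\<^esub> f" for g
  proof -
    obtain i where "i \<in> env_ideal sc br P" "g = i + f"
      using g by (auto simp: a_r_coset_def')
    then show ?thesis
      using env_ideal_subset_kernel by (auto simp: free_rep_plus)
  qed
  then have "(\<lambda>g. free_rep scw \<rho> g b) ` (env_ideal sc br P +>\<^bsub>free_algebra P\<^esub> f) = {free_rep scw \<rho> f b}"
    using a_rcos_self [OF assms] by blast
  then show ?thesis by (simp add: env_rep_def)
qed

text \<open>The ideal of the whole algebra meets the free algebra on \<open>P\<close> in an ideal
  containing the relators of \<open>P\<close>. This makes \<open>env_incl\<close> well defined on
  cosets.\<close>

lemma env_ideal_mono: "env_ideal sc br P \<subseteq> env_ideal sc br UNIV"
proof -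
  interpret U: ideal "env_ideal sc br UNIV" "free_algebra UNIV" by (rule ideal_env_ideal_UNIV)
  interpret R: ring "free_algebra P" by (rule ring_free_algebra)
  let ?K = "env_ideal sc br UNIV \<inter> carrier (free_algebra P)"
  have "ideal ?K (free_algebra P)"
  proof (rule idealI [OF ring_free_algebra])
    show "subgroup ?K (add_monoid (free_algebra P))"
    proof (rule R.add.subgroupI)
      fix f assume f: "f \<in> ?K"
      then have "- f \<in> env_ideal sc br UNIV"
        using U.I_l_closed [of f "- 1"] by simp
      then show "\<ominus>\<^bsub>free_algebra P\<^esub> f \<in> ?K"
        using f by (simp add: uminus_free_algebra)
    next
      fix f g assume "f \<in> ?K" "g \<in> ?K"
      then show "f \<oplus>\<^bsub>free_algebra P\<^esub> g \<in> ?K"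
        using additive_subgroup.a_closed [OF U.is_additive_subgroup, of f g] by (simp add: free_add_closed del: free_algebra_sel(1))
    next
      have "0 \<in> ?K" using additive_subgroup.zero_closed [OF U.is_additive_subgroup] by simp
      then show "?K \<noteq> {}" by blast
    qed blast
    fix f g assume f: "f \<in> ?K" and g: "g \<in> carrier (free_algebra P)"
    have "g * f \<in> env_ideal sc br UNIV" "f * g \<in> env_ideal sc br UNIV"
      using f U.I_l_closed [of f g] U.I_r_closed [of f g] by simp_all
    with f g show "g \<otimes>\<^bsub>free_algebra P\<^esub> f \<in> ?K" "f \<otimes>\<^bsub>free_algebra P\<^esub> g \<in> ?K"
      by (simp_all add: free_mult_closed del: free_algebra_sel(1))
  qed
  moreover have "env_relators sc br P \<subseteq> ?K"
  proof
    fix f assume f: "f \<in> env_relators sc br P"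
    then have "f \<in> env_relators sc br UNIV"
      unfolding env_relators_def by blast
    then show "f \<in> ?K"
      using f env_relators_closed env_relators_subset_ideal [of sc br] by blast
  qed
  ultimately show ?thesis
    using R.genideal_minimal [of ?K "env_relators sc br P"] by (auto simp: env_ideal_def [of sc br P])
qed

lemma env_incl_coset:
  assumes "f \<in> carrier (free_algebra P)"
  shows "env_incl sc br (env_ideal sc br P +>\<^bsub>free_algebra P\<^esub> f) = env_class sc br f"
proof -
  interpret ideal "env_ideal sc br P" "free_algebra P" by (rule ideal_env_ideal)
  have "env_class sc br g = env_class sc br f"
    if g: "g \<in> env_ideal sc br P +>\<^bsub>free_algebra P\<^esub> f" for g
  proof (rule env_class_eqI)
    obtain i where "i \<in> env_ideal sc br P" "g = i + f"
      using g by (auto simp: a_r_coset_def')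
    then show "g - f \<in> env_ideal sc br UNIV"
      using env_ideal_mono by auto
  qed
  then show ?thesis
    unfolding env_incl_def using a_rcos_self [OF assms] by blast
qed

end

section \<open>Induced modules\<close>

context subrep
begin

abbreviation E :: "'g free_alg set ring" where "E \<equiv> env_algebra sc br UNIV"
abbreviation cls :: "'g free_alg \<Rightarrow> 'g free_alg set" where "cls \<equiv> env_class sc br"
abbreviation N :: "('g, 'w) ind" where "N \<equiv> ind_null sc br P scw \<rho>"
abbreviation M :: "(complex, ('g, 'w) ind) module" where "M \<equiv> ind_module sc br P scw \<rho>"
abbreviation act :: "'g free_alg \<Rightarrow> ('g, 'w) ind \<Rightarrow> ('g, 'w) ind" where
  "act f \<equiv> ind_act sc br P scw \<rho> (cls f)"

interpretation E: ring E by (rule ring_env_algebra_UNIV)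

definition coset :: "('g free_alg set \<times> 'w \<Rightarrow>\<^sub>0 int) \<Rightarrow> ('g, 'w) ind" where
  "coset z = N #>\<^bsub>tensor_free E\<^esub> z"

definition pure :: "'g free_alg \<Rightarrow> 'w \<Rightarrow> ('g, 'w) ind" where
  "pure f b = coset (frag_of (cls f, b))"

definition relators :: "('g free_alg set \<times> 'w \<Rightarrow>\<^sub>0 int) set" where
  "relators = tensor_relators E (env_algebra sc br P)
     (\<lambda>a r. a \<otimes>\<^bsub>E\<^esub> env_incl sc br r) (env_rep scw \<rho>)"

definition lmult :: "'g free_alg \<Rightarrow> ('g free_alg set \<times> 'w \<Rightarrow>\<^sub>0 int) \<Rightarrow> ('g free_alg set \<times> 'w \<Rightarrow>\<^sub>0 int)" where
  "lmult f = frag_extend (\<lambda>(a, b). frag_of (cls f \<otimes>\<^bsub>E\<^esub> a, b))"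

text \<open>Choosing representatives in the free algebras evaluates \<open>env_incl\<close> and
  \<open>env_rep\<close>, so that the relators involve only products of free elements and
  \<open>free_rep\<close>.\<close>

lemma relator_cases:
  assumes "r \<in> relators"
  obtains (left) f g b where "r = frag_of (cls (f + g), b) - frag_of (cls f, b) - frag_of (cls g, b)"
  | (right) f b b' where "r = frag_of (cls f, b + b') - frag_of (cls f, b) - frag_of (cls f, b')"
  | (balanced) f p b where "p \<in> carrier (free_algebra P)"
      "r = frag_of (cls (f * p), b) - frag_of (cls f, free_rep scw \<rho> p b)"
proof -
  consider
    (1) a a' b where "r = frag_of (a \<oplus>\<^bsub>E\<^esub> a', b) - frag_of (a, b) - frag_of (a', b)"
      "a \<in> carrier E" "a' \<in> carrier E"
  | (2) a b b' where "r = frag_of (a, b + b') - frag_of (a, b) - frag_of (a, b')" "a \<in> carrier E"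
  | (3) a q b where "r = frag_of (a \<otimes>\<^bsub>E\<^esub> env_incl sc br q, b) - frag_of (a, env_rep scw \<rho> q b)"
      "a \<in> carrier E" "q \<in> carrier (env_algebra sc br P)"
    using assms unfolding relators_def tensor_relators_def Un_iff mem_Collect_eq by metis
  then show ?thesis
  proof cases
    case 1
    then obtain f g where "a = cls f" "a' = cls g"
      using env_class_surj by metis
    with 1 show ?thesis
      by (intro left [of f g b]) (simp add: env_class_add)
  next
    case 2
    then obtain f where "a = cls f"
      using env_class_surj by metis
    with 2 show ?thesis
      by (intro right [of f b b']) simp
  next
    case 3
    from 3(2) obtain f where f: "a = cls f" using env_class_surj by blast
    from 3(3) obtain p where p: "p \<in> carrier (free_algebra P)"
      and q: "q = env_ideal sc br P +>\<^bsub>free_algebra P\<^esub> p"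
      unfolding carrier_env_algebra by blast
    show ?thesis
      using balanced [OF p, of f b] 3(1)
      by (simp add: f q env_incl_coset [OF p] env_rep_coset [OF p] env_class_mult)
  qed
qed

lemma relator_left: "frag_of (cls (f + g), b) - frag_of (cls f, b) - frag_of (cls g, b) \<in> relators"
  unfolding relators_def tensor_relators_def env_class_add using env_class_closed by blast

lemma relator_right: "frag_of (cls f, b + b') - frag_of (cls f, b) - frag_of (cls f, b') \<in> relators"
  unfolding relators_def tensor_relators_def using env_class_closed by blast

lemma relator_balanced:
  assumes "p \<in> carrier (free_algebra P)"
  shows "frag_of (cls (f * p), b) - frag_of (cls f, free_rep scw \<rho> p b) \<in> relators"
proof -
  let ?q = "env_ideal sc br P +>\<^bsub>free_algebra P\<^esub> p"
  have "frag_of (cls f \<otimes>\<^bsub>E\<^esub> env_incl sc br ?q, b) - frag_of (cls f, env_rep scw \<rho> ?q b) \<in> relators"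
    unfolding relators_def tensor_relators_def carrier_env_algebra [of sc br P]
    using env_class_closed assms by blast
  then show ?thesis
    by (simp add: env_incl_coset [OF assms] env_rep_coset [OF assms] env_class_mult)
qed

lemma tensor_free_sel [simp]:
  "z \<in> carrier (tensor_free E) \<longleftrightarrow> Poly_Mapping.keys z \<subseteq> carrier E \<times> UNIV"
  "x \<otimes>\<^bsub>tensor_free E\<^esub> y = x + y"
  "\<one>\<^bsub>tensor_free E\<^esub> = 0"
  by (simp_all add: tensor_free_def)

lemma tensor_free_closed:
  fixes y z :: "'g free_alg set \<times> 'w \<Rightarrow>\<^sub>0 int"
  shows "frag_of (cls f, b) \<in> carrier (tensor_free E)"
    and "z \<in> carrier (tensor_free E) \<Longrightarrow> y \<in> carrier (tensor_free E) \<Longrightarrow> z - y \<in> carrier (tensor_free E)"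
    and "z \<in> carrier (tensor_free E) \<Longrightarrow> y \<in> carrier (tensor_free E) \<Longrightarrow> z + y \<in> carrier (tensor_free E)"
  using keys_diff [of z y] keys_add [of z y] by (auto simp: env_class_closed)

lemma comm_group_tensor_free: "comm_group (tensor_free E :: ('g free_alg set \<times> 'w \<Rightarrow>\<^sub>0 int) monoid)"
  unfolding tensor_free_def by (rule abelian_free_Abelian_group)

interpretation T: comm_group "tensor_free E :: ('g free_alg set \<times> 'w \<Rightarrow>\<^sub>0 int) monoid"
  by (rule comm_group_tensor_free)

lemma relators_closed: "relators \<subseteq> carrier (tensor_free E)"
proof
  fix r assume "r \<in> relators"
  then show "r \<in> carrier (tensor_free E)"
    by (cases rule: relator_cases)
      (auto simp del: tensor_free_sel(1) intro!: tensor_free_closed)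
qed

lemma N_eq: "N = generate (tensor_free E) relators"
  by (simp add: ind_null_def tensor_null_def relators_def)

lemma subgroup_N: "subgroup N (tensor_free E)"
  unfolding N_eq by (rule T.generate_is_subgroup [OF relators_closed])

lemma normal_N: "N \<lhd> tensor_free E"
  by (simp add: subgroup_N T.normal_iff_subgroup)

interpretation N: normal N "tensor_free E"
  by (rule normal_N)

lemma relator_in_N: "r \<in> relators \<Longrightarrow> r \<in> N"
  unfolding N_eq by (rule generate.incl)

lemma carrier_M: "carrier M = coset ` carrier (tensor_free E)"
  by (simp add: ind_module_def ind_group_def tensor_product_def carrier_FactGroup coset_def
      ind_null_def)

lemma coset_add:
  assumes "y \<in> carrier (tensor_free E)" "z \<in> carrier (tensor_free E)"
  shows "coset y \<oplus>\<^bsub>M\<^esub> coset z = coset (y + z)"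
  using N.rcos_sum [OF assms]
  by (simp add: ind_module_def ind_group_def tensor_product_def coset_def ind_null_def)

lemma zero_M: "\<zero>\<^bsub>M\<^esub> = coset 0"
  using T.coset_mult_one [of N] N.subset
  by (simp add: ind_module_def ind_group_def tensor_product_def coset_def ind_null_def)

lemma coset_eqI:
  assumes "y \<in> carrier (tensor_free E)" "z \<in> carrier (tensor_free E)" "y - z \<in> N"
  shows "coset y = coset z"
proof -
  have "y = (y - z) \<otimes>\<^bsub>tensor_free E\<^esub> z" by simp
  then have "y \<in> N #>\<^bsub>tensor_free E\<^esub> z"
    using assms(3) unfolding r_coset_def by blast
  then show ?thesis
    unfolding coset_def using T.repr_independence [OF _ assms(2) subgroup_N] by simp
qed

lemma abelian_group_M: "abelian_group M"
proof -
  have "comm_group (ind_group sc br P scw \<rho>)"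
    using T.abelian_FactGroup [OF subgroup_N]
    by (simp add: ind_group_def tensor_product_def ind_null_def)
  then interpret G: comm_group "ind_group sc br P scw \<rho>" .
  show ?thesis
  proof (rule abelian_groupI)
    fix x y z assume "x \<in> carrier M" "y \<in> carrier M" "z \<in> carrier M"
    then show "x \<oplus>\<^bsub>M\<^esub> y \<oplus>\<^bsub>M\<^esub> z = x \<oplus>\<^bsub>M\<^esub> (y \<oplus>\<^bsub>M\<^esub> z)"
      by (simp add: ind_module_def G.m_assoc)
  next
    fix x y assume "x \<in> carrier M" "y \<in> carrier M"
    then show "x \<oplus>\<^bsub>M\<^esub> y = y \<oplus>\<^bsub>M\<^esub> x"
      by (simp add: ind_module_def G.m_comm)
  next
    fix x assume "x \<in> carrier M"
    then show "\<exists>y\<in>carrier M. y \<oplus>\<^bsub>M\<^esub> x = \<zero>\<^bsub>M\<^esub>"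
      by (simp add: ind_module_def G.l_inv_ex)
  qed (simp_all add: ind_module_def)
qed

interpretation M: abelian_group M by (rule abelian_group_M)

section \<open>The action of the enveloping algebra on the induced module\<close>

lemma lmult_closed:
  assumes "z \<in> carrier (tensor_free E)"
  shows "lmult f z \<in> carrier (tensor_free E)"
proof -
  have "Poly_Mapping.keys (lmult f z)
      \<subseteq> (\<Union>x\<in>Poly_Mapping.keys z. Poly_Mapping.keys (case x of (a, b) \<Rightarrow> frag_of (cls f \<otimes>\<^bsub>E\<^esub> a, b)))"
    unfolding lmult_def by (rule keys_frag_extend)
  also have "\<dots> \<subseteq> carrier E \<times> UNIV"
    using assms env_class_closed [of sc br f] by (auto split: if_splits)
  finally show ?thesis by simp
qed

lemma lmult_frag_of: "lmult f (frag_of (cls g, b)) = frag_of (cls (f * g), b)"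
  by (simp add: lmult_def env_class_mult)

lemma lmult_add: "lmult f (y + z) = lmult f y + lmult f z"
  by (simp add: lmult_def frag_extend_add)

text \<open>Left multiplication is additive and commutes with right multiplication, so each kind of
  relator goes to the same kind; the balanced one uses associativity.\<close>

lemma lmult_relators:
  assumes "r \<in> relators"
  shows "lmult f r \<in> relators"
  using assms
proof (cases rule: relator_cases)
  case (left g g' b)
  have "lmult f r = frag_of (cls (f * g + f * g'), b) - frag_of (cls (f * g), b) - frag_of (cls (f * g'), b)"
    unfolding left by (simp add: lmult_def frag_extend_diff env_class_mult flip: distrib_left)
  then show ?thesis by (simp only: relator_left)
next
  case (right g b b')
  have "lmult f r = frag_of (cls (f * g), b + b') - frag_of (cls (f * g), b) - frag_of (cls (f * g), b')"
    unfolding right by (simp add: lmult_def frag_extend_diff env_class_mult)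
  then show ?thesis by (simp only: relator_right)
next
  case (balanced g p b)
  have "lmult f r = frag_of (cls ((f * g) * p), b) - frag_of (cls (f * g), free_rep scw \<rho> p b)"
    unfolding balanced by (simp add: lmult_def frag_extend_diff env_class_mult mult.assoc
      E.m_assoc env_class_closed)
  then show ?thesis by (simp only: relator_balanced [OF balanced(1)])
qed

lemma lmult_N:
  assumes "z \<in> N"
  shows "lmult f z \<in> N"
  using assms unfolding N_eq
proof (induction z rule: generate.induct)
  case one
  then show ?case
    using generate.one [of "tensor_free E" relators] by (simp add: lmult_def)
next
  case (incl h)
  then show ?case by (intro generate.incl lmult_relators)
next
  case (inv h)
  have inv_eq: "inv\<^bsub>tensor_free E\<^esub> z = - z" if "z \<in> relators" for z
    using relators_closed that by (auto simp: tensor_free_def)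
  have "lmult f (- h) = - lmult f h"
    by (simp add: lmult_def frag_extend_minus)
  with inv generate.inv [OF lmult_relators [OF inv], of "tensor_free E" f] show ?case
    by (simp add: inv_eq lmult_relators)
next
  case (eng h h')
  then show ?case
    using generate.eng [OF eng.IH] by (simp add: lmult_def frag_extend_add)
qed

text \<open>By \<open>lmult_N\<close> all representatives yield the same coset, so the union in
  \<open>ind_act\<close> collapses to it.\<close>

lemma act_coset:
  assumes z: "z \<in> carrier (tensor_free E)"
  shows "act f (coset z) = coset (lmult f z)"
proof -
  have eq: "coset (lmult f y) = coset (lmult f z)" if y: "y \<in> coset z" for y
  proof -
    obtain n where n: "n \<in> N" and "y = n + z"
      using y by (auto simp: coset_def r_coset_def)
    then have "lmult f y - lmult f z = lmult f n" "y \<in> carrier (tensor_free E)"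
      using z N.mem_carrier [OF n] tensor_free_closed(3) [of n z] by (simp_all add: lmult_def frag_extend_add)
    then show ?thesis
      using n z by (intro coset_eqI lmult_closed) (auto simp: lmult_N)
  qed
  have "z \<in> coset z"
    unfolding coset_def by (rule T.rcos_self [OF z subgroup_N])
  have "act f (coset z) = (\<Union>y\<in>coset z. coset (lmult f y))"
    by (simp add: ind_act_def coset_def lmult_def)
  also have "\<dots> = coset (lmult f z)"
    using eq \<open>z \<in> coset z\<close> by blast
  finally show ?thesis .
qed

lemma act_closed [simp]: "v \<in> carrier M \<Longrightarrow> act f v \<in> carrier M"
  by (auto simp: carrier_M act_coset lmult_closed simp del: tensor_free_sel(1))

lemma act_add:
  assumes "v \<in> carrier M" "w \<in> carrier M"
  shows "act f (v \<oplus>\<^bsub>M\<^esub> w) = act f v \<oplus>\<^bsub>M\<^esub> act f w"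
proof -
  obtain y z where y: "y \<in> carrier (tensor_free E)" "v = coset y"
    and z: "z \<in> carrier (tensor_free E)" "w = coset z"
    using assms unfolding carrier_M by blast
  then show ?thesis
    by (simp add: act_coset lmult_closed coset_add lmult_add tensor_free_closed(3)
        del: tensor_free_sel(1))
qed

lemma pure_closed [simp]: "pure f b \<in> carrier M"
  by (auto simp: carrier_M pure_def intro!: imageI tensor_free_closed simp del: tensor_free_sel(1))

lemma act_pure: "act f (pure g b) = pure (f * g) b"
  by (simp add: pure_def act_coset tensor_free_closed lmult_frag_of del: tensor_free_sel(1))

lemma pure_add_left: "pure (f + g) b = pure f b \<oplus>\<^bsub>M\<^esub> pure g b"
  unfolding pure_def
  by (simp only: coset_add tensor_free_closed)
    (intro coset_eqI tensor_free_closed relator_in_N,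
      use relator_left [of f g b] in \<open>simp add: diff_diff_eq\<close>)

lemma pure_add_right: "pure f (b + b') = pure f b \<oplus>\<^bsub>M\<^esub> pure f b'"
  unfolding pure_def
  by (simp only: coset_add tensor_free_closed)
    (intro coset_eqI tensor_free_closed relator_in_N,
      use relator_right [of f b b'] in \<open>simp add: diff_diff_eq\<close>)

lemma pure_balanced:
  "p \<in> carrier (free_algebra P) \<Longrightarrow> pure (f * p) b = pure f (free_rep scw \<rho> p b)"
  unfolding pure_def by (intro coset_eqI tensor_free_closed relator_in_N relator_balanced)

lemma pure_zero [simp]: "pure 0 b = \<zero>\<^bsub>M\<^esub>"
  using pure_add_left [of 0 0 b] by (simp add: M.add.r_cancel_one')

lemma pure_uminus: "\<ominus>\<^bsub>M\<^esub> pure f b = pure (- f) b"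
  by (rule M.minus_equality) (simp_all flip: pure_add_left)

text \<open>The pure tensors are closed under negation, because the sign can be absorbed into the
  first factor; hence their sums already exhaust the module.\<close>

lemma M_induct [consumes 1, case_names pure add]:
  assumes "v \<in> carrier M"
    and pure: "\<And>f b. Q (pure f b)"
    and add: "\<And>v w. v \<in> carrier M \<Longrightarrow> w \<in> carrier M \<Longrightarrow> Q v \<Longrightarrow> Q w \<Longrightarrow> Q (v \<oplus>\<^bsub>M\<^esub> w)"
  shows "Q v"
proof -
  \<comment> \<open>\<open>frag_induction\<close> forms differences while \<open>Q\<close> is closed
    under sums, so the invariant also tracks negatives.\<close>
  let ?R = "\<lambda>z. z \<in> carrier (tensor_free E) \<and> Q (coset z) \<and> Q (coset (- z))"
  have R: "?R z" if "Poly_Mapping.keys z \<subseteq> carrier E \<times> UNIV" for z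
    using that
  proof (induction z rule: frag_induction)
    case zero
    then show ?case using pure [of 0] by (simp add: zero_M)
  next
    case (one x)
    then obtain f b where x: "x = (cls f, b)"
      using env_class_surj by blast
    have c: "frag_of (cls f, b) \<in> carrier (tensor_free E)"
      by (rule tensor_free_closed)
    then have "coset (- frag_of (cls f, b)) = \<ominus>\<^bsub>M\<^esub> coset (frag_of (cls f, b))"
      by (intro M.minus_equality [symmetric])
        (auto simp: coset_add zero_M carrier_M intro!: imageI)
    then have "coset (- frag_of (cls f, b)) = pure (- f) b"
      by (simp add: pure_def [of f, symmetric] pure_uminus)
    with c show ?case
      unfolding x using pure [of f b] pure [of "- f" b] by (simp add: pure_def)
  next
    case (diff a b)
    then have a: "a \<in> carrier (tensor_free E)" "- a \<in> carrier (tensor_free E)"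
      and b: "b \<in> carrier (tensor_free E)" "- b \<in> carrier (tensor_free E)"
      by auto
    have "coset (a - b) = coset a \<oplus>\<^bsub>M\<^esub> coset (- b)" "coset (- (a - b)) = coset (- a) \<oplus>\<^bsub>M\<^esub> coset b"
      using a b by (simp_all add: coset_add del: tensor_free_sel(1))
    with diff a b show ?case
      by (simp add: carrier_M add tensor_free_closed del: tensor_free_sel(1))
  qed
  show ?thesis
    using assms(1) R by (auto simp: carrier_M)
qed

lemma act_plus:
  assumes "v \<in> carrier M"
  shows "act (f + g) v = act f v \<oplus>\<^bsub>M\<^esub> act g v"
  using assms
proof (induction v rule: M_induct)
  case (pure h b)
  then show ?case by (simp add: act_pure distrib_right pure_add_left)
next
  case (add v w)
  then show ?case by (simp add: act_add M.add.m_ac)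
qed

lemma act_mult:
  assumes "v \<in> carrier M"
  shows "act (f * g) v = act f (act g v)"
  using assms
proof (induction v rule: M_induct)
  case (pure h b)
  then show ?case by (simp add: act_pure mult.assoc)
next
  case (add v w)
  then show ?case by (simp add: act_add)
qed

lemma act_one:
  assumes "v \<in> carrier M"
  shows "act 1 v = v"
  using assms
proof (induction v rule: M_induct)
  case (pure h b)
  then show ?case by (simp add: act_pure)
next
  case (add v w)
  then show ?case by (simp add: act_add)
qed

lemma smult_M: "c \<odot>\<^bsub>M\<^esub> v = act (const c) v"
  by (simp add: ind_module_def)

lemma complex_module_M: "complex_module M"
  by unfold_locales
    (simp_all add: smult_M act_add const_add act_plus const_mult act_mult const_one act_one)

lemma act_smult: "v \<in> carrier M \<Longrightarrow> act f (c \<odot>\<^bsub>M\<^esub> v) = c \<odot>\<^bsub>M\<^esub> act f v"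
  by (simp add: smult_M const_commute flip: act_mult)

text \<open>The scalar, being central, moves to the right of \<open>f\<close> and then crosses the
  tensor sign by balancedness.\<close>

lemma smult_pure: "c \<odot>\<^bsub>M\<^esub> pure f b = pure f (scw c b)"
  by (simp add: smult_M act_pure const_commute pure_balanced const_closed del: free_algebra_sel(1))

lemma act_commute:
  assumes "v \<in> carrier M"
  shows "act (gen x) (act (gen y) v) = act (gen y) (act (gen x) v) \<oplus>\<^bsub>M\<^esub> act (gen (br x y)) v"
proof -
  have "gen x * gen y - (gen y * gen x + gen (br x y)) \<in> env_ideal sc br UNIV"
    using env_relators_subset_ideal [of sc br] by (force simp: env_relators_def diff_diff_eq)
  then have "cls (gen x * gen y) = cls (gen y * gen x + gen (br x y))"
    by (rule env_class_eqI)
  then have "act (gen x * gen y) v = act (gen y * gen x + gen (br x y)) v"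
    by simp
  with assms show ?thesis
    by (simp only: act_mult act_plus)
qed

text \<open>Induction on the first factor of a pure tensor turns each leading generator into the
  action of a Lie algebra element, down to a scalar multiple of some
  \<open>1 \<otimes> b\<close>.\<close>

lemma cyclic_induct [consumes 1, case_names pure smult add act]:
  assumes "v \<in> carrier M"
    and pure: "\<And>b. Q (pure 1 b)"
    and smult: "\<And>c v. v \<in> carrier M \<Longrightarrow> Q v \<Longrightarrow> Q (c \<odot>\<^bsub>M\<^esub> v)"
    and add: "\<And>v w. v \<in> carrier M \<Longrightarrow> w \<in> carrier M \<Longrightarrow> Q v \<Longrightarrow> Q w \<Longrightarrow> Q (v \<oplus>\<^bsub>M\<^esub> w)"
    and act: "\<And>x v. v \<in> carrier M \<Longrightarrow> Q v \<Longrightarrow> Q (act (gen x) v)"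
  shows "Q v"
  using assms(1)
proof (induction v rule: M_induct)
  case (pure f b)
  have "f \<in> carrier (free_algebra UNIV)" by simp
  then show ?case
  proof (induction f rule: free_algebra_induct)
    case (const c)
    have "pure (const c) b = c \<odot>\<^bsub>M\<^esub> pure 1 b"
      by (simp add: smult_M act_pure)
    then show ?case by (simp add: smult \<open>\<And>b. Q (pure 1 b)\<close>)
  next
    case (add f g)
    then show ?case by (simp add: pure_add_left \<open>\<And>v w. v \<in> carrier M \<Longrightarrow> w \<in> carrier M \<Longrightarrow> Q v \<Longrightarrow> Q w \<Longrightarrow> Q (v \<oplus>\<^bsub>M\<^esub> w)\<close>)
  next
    case (gen x f)
    then show ?case by (simp add: act flip: act_pure)
  qed
qed (rule add)

lemma act_gen_plus:
  assumes "v \<in> carrier M"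
  shows "act (gen (x + y)) v = act (gen x) v \<oplus>\<^bsub>M\<^esub> act (gen y) v"
proof -
  have "gen (x + y) - (gen x + gen y) \<in> env_ideal sc br UNIV"
    using env_relators_subset_ideal [of sc br] by (force simp: env_relators_def diff_diff_eq)
  then have "act (gen (x + y)) v = act (gen x + gen y) v"
    by (simp add: env_class_eqI)
  with assms show ?thesis
    by (simp only: act_plus)
qed

lemma act_gen_zero: "v \<in> carrier M \<Longrightarrow> act (gen 0) v = \<zero>\<^bsub>M\<^esub>"
  using act_gen_plus [of v 0 0] by (simp add: M.add.r_cancel_one')

lemma act_zero [simp]: "act f \<zero>\<^bsub>M\<^esub> = \<zero>\<^bsub>M\<^esub>"
  using act_add [of "\<zero>\<^bsub>M\<^esub>" "\<zero>\<^bsub>M\<^esub>" f] by (simp add: M.add.r_cancel_one')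

lemma pure_zero_right: "pure f 0 = \<zero>\<^bsub>M\<^esub>"
  using pure_add_right [of f 0 0] by (simp add: M.add.r_cancel_one')

lemma act_pure_one: "x \<in> P \<Longrightarrow> act (gen x) (pure 1 b) = pure 1 (\<rho> x b)"
  using pure_balanced [OF gen_closed, of x 1 b] by (simp add: act_pure)

end

section \<open>The Heisenberg modes\<close>

locale heisenberg =
  fixes scale :: "complex \<Rightarrow> 'h::ab_group_add \<Rightarrow> 'h"
    and form :: "'h \<Rightarrow> 'h \<Rightarrow> complex"
    and l :: complex
  assumes form_zero_left [simp]: "form 0 y = 0"
    and form_zero_right [simp]: "form x 0 = 0"
begin

text \<open>Nonnegative exponents of \<open>s\<close> sum to zero only if both vanish, and then the
  factor \<open>m\<close> in the bracket is zero. So brackets in \<open>aff_nonneg\<close> vanish,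
  matching the fact that the operators of \<open>vac_rep l\<close> are scalars and commute.\<close>

lemma subrep_vac_rep:
  "subrep (aff_scale scale) (aff_bracket form) aff_nonneg (*) (vac_rep l)"
proof
  fix x y :: "'h affine" and b :: complex
  assume x: "x \<in> aff_nonneg" and y: "y \<in> aff_nonneg"
  obtain f a g c where fg: "x = (f, a)" "y = (g, c)"
    by (cases x, cases y)
  have "of_int m * (\<Sum>i\<le>degree (Poly_Mapping.lookup f m).
      form (coeff (Poly_Mapping.lookup f m) i) (coeff (Poly_Mapping.lookup g (- m)) i)) = 0"
    if "m \<in> Poly_Mapping.keys f" for m
  proof -
    have "m \<ge> 0"
      using x that unfolding fg aff_nonneg_def by (force simp: in_keys_iff)
    then have "m = 0 \<or> Poly_Mapping.lookup g (- m) = 0"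
      using y unfolding fg aff_nonneg_def by force
    then show ?thesis by auto
  qed
  then have "aff_bracket form x y = (0, 0)"
    unfolding fg aff_bracket_def by (simp add: sum.neutral)
  then show "vac_rep l (aff_bracket form x y) b
      = vac_rep l x (vac_rep l y b) - vac_rep l y (vac_rep l x b)"
    by (simp add: fg vac_rep_def)
qed (auto simp: aff_nonneg_def aff_scale_def aff_bracket_def vac_rep_def lookup_add
    Poly_Mapping.map.rep_eq algebra_simps split: prod.splits)

sublocale ind: subrep "aff_scale scale" "aff_bracket form" aff_nonneg "(*)" "vac_rep l"
  by (rule subrep_vac_rep)

abbreviation V :: "(complex, 'h fock) module" where "V \<equiv> heis_module scale form l"

lemma V_eq: "V = ind_module (aff_scale scale) (aff_bracket form) aff_nonneg (*) (vac_rep l)"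
  by (simp add: heis_module_def)

sublocale V: complex_module V
  unfolding V_eq by (rule ind.complex_module_M)

abbreviation act :: "'h affine \<Rightarrow> 'h fock \<Rightarrow> 'h fock" where
  "act x \<equiv> ind_act (aff_scale scale) (aff_bracket form) aff_nonneg (*) (vac_rep l)
     (env_class (aff_scale scale) (aff_bracket form) (gen x))"

text \<open>On \<open>1 \<otimes> b\<close> the value comes from \<open>vac_rep l\<close>; since
  brackets with a central element vanish, the scalar persists under the action of further
  elements.\<close>

lemma act_central:
  assumes "v \<in> carrier V"
  shows "act (0, c) v = (l * c) \<odot>\<^bsub>V\<^esub> v"
  using assms unfolding V_eq
proof (induction v rule: ind.cyclic_induct)
  case (pure b)
  have "(0, c) \<in> (aff_nonneg :: 'h affine set)"
    by (simp add: aff_nonneg_def)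
  then show ?case
    by (simp only: ind.act_pure_one ind.smult_pure) (simp add: vac_rep_def)
next
  case (smult b v)
  then show ?case
    by (simp add: ind.act_smult mult.commute [of b] flip: V.smult_assoc [unfolded V_eq])
next
  case (add v w)
  then show ?case by (simp add: ind.act_add V.smult_r_distr [unfolded V_eq])
next
  case (act x v)
  have "aff_bracket form (0, c) x = 0"
    by (simp add: aff_bracket_def zero_prod_def split: prod.splits)
  with act show ?case
    by (simp add: ind.act_commute ind.act_gen_zero ind.act_smult V.r_zero [unfolded V_eq]
        V.smult_closed [unfolded V_eq])
qed

lemma aff_bracket_monom:
  "aff_bracket form (aff_elem (Polynomial.monom x j) n) (g, c)
     = (0, of_int n * form x (coeff (Poly_Mapping.lookup g (- n)) j))"
\<comment> \<open>For nonzero \<open>x\<close> the monomial has degree exactly \<open>j\<close>, so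
  the sum reaches its only possibly nonzero term; for \<open>x = 0\<close> both sides
  vanish.\<close>
proof (cases "x = 0")
  case True
  then show ?thesis by (simp add: aff_bracket_def aff_elem_def)
next
  case False
  then have "(\<Sum>i\<le>degree (Polynomial.monom x j). form (coeff (Polynomial.monom x j) i) (coeff (Poly_Mapping.lookup g (- n)) i))
      = (\<Sum>i\<le>j. if i = j then form x (coeff (Poly_Mapping.lookup g (- n)) j) else 0)"
    by (intro sum.cong) (auto simp: degree_monom_eq)
  then show ?thesis
    using False by (simp add: aff_bracket_def aff_elem_def)
qed

lemma mode_eq: "mode scale form l a n = act (aff_elem a n)"
  by (simp add: mode_def)

lemma mode_closed [simp]: "v \<in> carrier V \<Longrightarrow> mode scale form l a n v \<in> carrier V"
  by (simp add: mode_eq V_eq)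

text \<open>The second element is arbitrary because \<open>cyclic_induct\<close> applies arbitrary
  Lie algebra elements. All brackets are central, so the commutator acts as a scalar.\<close>

lemma mode_act:
  assumes "v \<in> carrier V"
  shows "mode scale form l (Polynomial.monom x j) n (act (g, c) v)
    = act (g, c) (mode scale form l (Polynomial.monom x j) n v)
      \<oplus>\<^bsub>V\<^esub> (l * (of_int n * form x (coeff (Poly_Mapping.lookup g (- n)) j))) \<odot>\<^bsub>V\<^esub> v"
proof -
  let ?e = "aff_elem (Polynomial.monom x j) n"
  have "act ?e (act (g, c) v) = act (g, c) (act ?e v)
      \<oplus>\<^bsub>V\<^esub> act (aff_bracket form ?e (g, c)) v"
    using assms unfolding V_eq by (rule ind.act_commute)
  also have "act (aff_bracket form ?e (g, c)) v
      = (l * (of_int n * form x (coeff (Poly_Mapping.lookup g (- n)) j))) \<odot>\<^bsub>V\<^esub> v"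
    unfolding aff_bracket_monom by (rule act_central [OF assms])
  finally show ?thesis
    by (simp add: mode_eq)
qed

lemma mode_commute:
  assumes "v \<in> carrier V"
  shows "mode scale form l (Polynomial.monom x j) m (mode scale form l (Polynomial.monom y i) n v)
    = mode scale form l (Polynomial.monom y i) n (mode scale form l (Polynomial.monom x j) m v)
      \<oplus>\<^bsub>V\<^esub> (if i = j \<and> m + n = 0 then l * of_int m * form x y else 0) \<odot>\<^bsub>V\<^esub> v"
proof -
  have "l * (of_int m * form x (coeff (Poly_Mapping.lookup (Poly_Mapping.single n (Polynomial.monom y i)) (- m)) j))
      = (if i = j \<and> m + n = 0 then l * of_int m * form x y else 0)"
    by (auto simp: lookup_single when_def)
  then show ?thesis
    using mode_act [OF assms, of x j m "Poly_Mapping.single n (Polynomial.monom y i)" 0]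
    unfolding mode_eq [of "Polynomial.monom y i" n] aff_elem_def [of "Polynomial.monom y i" n]
    by simp
qed

text \<open>Nonnegative modes kill \<open>1 \<otimes> b\<close>. A further element
  \<open>(g, c)\<close> enlarges the set of surviving modes at most by those with a nonzero
  commutator, and \<open>g\<close> has finitely many coefficients.\<close>

lemma mode_finite:
  assumes "finite I" "v \<in> carrier V"
  shows "finite {((i, j), n). i \<in> I \<and> 0 \<le> n \<and> mode scale form l (Polynomial.monom (u i) j) n v \<noteq> \<zero>\<^bsub>V\<^esub>}"
    (is "finite (?F v)")
  using assms(2) unfolding V_eq
proof (induction v rule: ind.cyclic_induct)
  case (pure b)
  have "mode scale form l a n (ind.pure 1 b) = \<zero>\<^bsub>V\<^esub>" if "n \<ge> 0" for a n
  proof -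
    have "aff_elem a n \<in> aff_nonneg"
      using that by (simp add: aff_elem_def aff_nonneg_def lookup_single when_def)
    then have "mode scale form l a n (ind.pure 1 b) = ind.pure 1 (vac_rep l (aff_elem a n) b)"
      unfolding mode_eq by (rule ind.act_pure_one)
    also have "vac_rep l (aff_elem a n) b = 0"
      by (simp add: vac_rep_def aff_elem_def)
    finally show ?thesis
      by (simp only: ind.pure_zero_right V_eq)
  qed
  then have "?F (ind.pure 1 b) = {}" by auto
  then show ?case unfolding V_eq by (simp only: finite.emptyI)
next
  case (smult c v)
  show ?case
    by (rule finite_subset [OF _ smult.IH])
      (use smult.hyps V.smult_zero_right in \<open>auto simp: mode_eq ind.act_smult V_eq\<close>)
next
  case (add v w)
  show ?case
    by (rule finite_subset [OF _ finite_UnI [OF add.IH]])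
      (use add.hyps V.r_zero in \<open>auto simp: mode_eq ind.act_add V_eq\<close>)
next
  case (act x v)
  obtain g c where x: "x = (g, c)" by (cases x)
  have v: "v \<in> carrier V" using act.hyps by (simp add: V_eq)
  \<comment> \<open>These are the candidates for a nonzero bracket with \<open>(g, c)\<close>:
    \<open>- n\<close> is an exponent of \<open>s\<close> in \<open>g\<close>, and \<open>j\<close>
    is at most the degree of the polynomial found there.\<close>
  let ?B = "(\<lambda>(i, m, j). ((i, j), - m)) `
      (I \<times> (SIGMA m : Poly_Mapping.keys g. {..degree (Poly_Mapping.lookup g m)}))"
  have "?F (act x v) \<subseteq> ?F v \<union> ?B"
  proof
    fix z assume "z \<in> ?F (act x v)"
    then obtain i j n where z: "z = ((i, j), n)" and i: "i \<in> I" and n: "0 \<le> n"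
      and nz: "mode scale form l (Polynomial.monom (u i) j) n (act x v) \<noteq> \<zero>\<^bsub>V\<^esub>"
      by auto
    show "z \<in> ?F v \<union> ?B"
    proof (cases "coeff (Poly_Mapping.lookup g (- n)) j = 0")
      case True
      then have "mode scale form l (Polynomial.monom (u i) j) n v \<noteq> \<zero>\<^bsub>V\<^esub>"
        using nz v ind.act_zero [folded V_eq] by (auto simp: x mode_act)
      then show ?thesis using z i n by simp
    next
      case False
      then have "- n \<in> Poly_Mapping.keys g" "j \<le> degree (Poly_Mapping.lookup g (- n))"
        by (auto simp: in_keys_iff le_degree)
      then have "(i, - n, j) \<in> I \<times> (SIGMA m : Poly_Mapping.keys g. {..degree (Poly_Mapping.lookup g m)})"
        using i by simp
      moreover have "z = (\<lambda>(i, m, j). ((i, j), - m)) (i, - n, j)"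
        by (simp add: z)
      ultimately show ?thesis by blast
    qed
  qed
  moreover have "finite (?F v \<union> ?B)"
    using act.IH assms(1) unfolding V_eq by (intro finite_UnI finite_imageI finite_cartesian_product finite_SigmaI) auto
  ultimately show ?case
    unfolding V_eq by (rule finite_subset)
qed

end

section \<open>The Virasoro operators on the Heisenberg module\<close>

locale orthonormal_heisenberg = heisenberg scale form l
  for scale :: "complex \<Rightarrow> 'h::ab_group_add \<Rightarrow> 'h" and form l +
  fixes u :: "nat \<Rightarrow> 'h" and d :: nat
  assumes orthonormal: "i \<in> {1..d} \<Longrightarrow> j \<in> {1..d} \<Longrightarrow> form (u i) (u j) = (if i = j then 1 else 0)"
    and l_nonzero: "l \<noteq> 0"
begin

abbreviation A :: "nat \<times> nat \<Rightarrow> int \<Rightarrow> 'h fock \<Rightarrow> 'h fock" where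
  "A \<equiv> \<lambda>(i, j). mode scale form l (Polynomial.monom (u i) j)"

sublocale oscillators V "{1..d} \<times> UNIV" A l
proof
  fix s t :: "nat \<times> nat" and v w :: "'h fock" and m n :: int and c :: complex
  show "finite {(s, n). s \<in> {1..d} \<times> UNIV \<and> 0 \<le> n \<and> A s n v \<noteq> \<zero>\<^bsub>V\<^esub>}" if "v \<in> carrier V"
    using mode_finite [OF _ that, of "{1..d}" u]
    by (rule finite_subset [rotated]) auto
  assume s: "s \<in> {1..d} \<times> UNIV"
  show "A s n v \<in> carrier V" if "v \<in> carrier V"
    using that by (cases s) simp
  show "A s n (v \<oplus>\<^bsub>V\<^esub> w) = A s n v \<oplus>\<^bsub>V\<^esub> A s n w" if "v \<in> carrier V" "w \<in> carrier V"
    using that by (cases s) (simp add: mode_eq V_eq ind.act_add)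
  show "A s n (c \<odot>\<^bsub>V\<^esub> v) = c \<odot>\<^bsub>V\<^esub> A s n v" if "v \<in> carrier V"
    using that by (cases s) (simp add: mode_eq V_eq ind.act_smult)
  show "A s m (A t n v) = A t n (A s m v)
      \<oplus>\<^bsub>V\<^esub> (if s = t \<and> m + n = 0 then l * of_int m else 0) \<odot>\<^bsub>V\<^esub> v"
    if "t \<in> {1..d} \<times> UNIV" "v \<in> carrier V"
  proof (cases s, cases t)
    fix i j i' j' assume st: "s = (i, j)" "t = (i', j')"
    \<comment> \<open>Orthonormality of \<open>u\<close> together with equality of the exponents of
      \<open>t\<close> amounts to equality of the index pairs.\<close>
    have "(if j' = j \<and> m + n = 0 then l * of_int m * form (u i) (u i') else 0)
        = (if s = t \<and> m + n = 0 then l * of_int m else 0)"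
      using s that(1) by (auto simp: st orthonormal)
    with mode_commute [OF that(2), of "u i" j m "u i'" j' n] show ?thesis
      by (simp only: st prod.case)
  qed
qed (rule l_nonzero)

text \<open>For nonzero \<open>n\<close> the two modes commute. For \<open>n = 0\<close>,
  \<open>normal_ordered\<close> keeps \<open>- m\<close> on the left exactly if
  \<open>m \<ge> 0\<close>, which again puts the larger index on the right.\<close>

lemma normal_ordered_eq_ordered:
  assumes "n \<ge> -1" "i \<in> {1..d}" "v \<in> carrier V"
  shows "normal_ordered scale form l (Polynomial.monom (u i) j) (n - m) (Polynomial.monom (u i) j) m v
    = ordered n (i, j) m v"
proof (cases "n - m \<ge> 0 \<and> m < 0")
  case True
  then show ?thesis by (simp add: normal_ordered_def ordered_def)
next
  case False
  then have "A (i, j) (n - m) (A (i, j) m v) = ordered n (i, j) m v"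
    using assms by (intro A_A_eq_ordered) auto
  with False show ?thesis unfolding normal_ordered_def by (simp only: if_False prod.case)
qed

text \<open>Stated for every \<open>n\<close>, since in the case \<open>m = n = -1\<close> the
  relation mentions the operator of index -2, with coefficient zero.\<close>

lemma vir_op_closed:
  assumes "v \<in> carrier V"
  shows "vir_op scale form l u d n v \<in> carrier V"
proof -
  have "normal_ordered scale form l a p b q v \<in> carrier V" for a p b q
    using assms by (simp add: normal_ordered_def)
  then show ?thesis
    unfolding vir_op_def Let_def by (intro V.smult_closed V.finsum_closed) auto
qed

text \<open>Both sums run over the same terms once the triple \<open>(i, j, m)\<close> is regrouped
  as the oscillator \<open>(i, j)\<close> and the label \<open>m\<close>.\<close>

lemma vir_op_eq_vir:
  assumes v: "v \<in> carrier V" and n: "n \<ge> -1"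
  shows "vir_op scale form l u d n v = vir n v"
proof -
  let ?I = "{1..d} \<times> (UNIV :: nat set) \<times> (UNIV :: int set)"
  let ?t = "\<lambda>(i, j, m). normal_ordered scale form l (Polynomial.monom (u i) j) (n - m)
                                             (Polynomial.monom (u i) j) m v"
  let ?p = "\<lambda>(i, j, m). ((i, j), m)"
  let ?f = "\<lambda>(s, k). ordered n s k v"
  have bij: "bij_betw ?p ?I (({1..d} \<times> UNIV) \<times> UNIV)"
    by (rule bij_betwI [of _ _ _ "\<lambda>((i, j), m). (i, j, m)"]) auto
  have "vir_op scale form l u d n v = (1 / (2 * l)) \<odot>\<^bsub>V\<^esub> V.gsum ?t ?I"
    by (simp only: vir_op_def V.gsum_def Let_def)
  also have "V.gsum ?t ?I = V.gsum (\<lambda>x. ?f (?p x)) ?I"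
    by (rule V.gsum_cong) (use v n in \<open>auto simp: normal_ordered_eq_ordered\<close>)
  also have "\<dots> = V.gsum ?f (({1..d} \<times> UNIV) \<times> UNIV)"
    by (rule V.gsum_reindex [OF bij]) (use v in auto)
  finally show ?thesis by (simp only: vir_def)
qed

end

theorem theorem3p3:
  fixes scale :: "complex \<Rightarrow> 'h::ab_group_add \<Rightarrow> 'h"
    and form :: "'h \<Rightarrow> 'h \<Rightarrow> complex"
    and u :: "nat \<Rightarrow> 'h" and d :: nat
    and l :: complex and m n :: int
  assumes basis: "finite_dimensional_vector_space scale (u ` {1..d})"
    and orthonormal:
      "\<And>i j. i \<in> {1..d} \<Longrightarrow> j \<in> {1..d} \<Longrightarrow> form (u i) (u j) = (if i = j then 1 else 0)"
    and linear_left: "\<And>y. Vector_Spaces.linear scale (*) (\<lambda>x. form x y)"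
    and linear_right: "\<And>x. Vector_Spaces.linear scale (*) (form x)"
    and symmetric: "\<And>x y. form x y = form y x"
    and nondegenerate: "\<And>x. (\<And>y. form x y = 0) \<Longrightarrow> x = 0"
    and "l \<noteq> 0" and "m \<ge> -1" and "n \<ge> -1"
  shows "\<forall>v \<in> carrier (heis_module scale form l).
           vir_op scale form l u d m (vir_op scale form l u d n v)
             \<ominus>\<^bsub>heis_module scale form l\<^esub> vir_op scale form l u d n (vir_op scale form l u d m v)
           = of_int (m - n) \<odot>\<^bsub>heis_module scale form l\<^esub> vir_op scale form l u d (m + n) v"
proof
  have "module_hom scale (*) (form x)" "module_hom scale (*) (\<lambda>x. form x y)" for x y
    using linear_left linear_right by (simp_all flip: linear_iff_module_hom)
  then interpret orthonormal_heisenberg scale form l u d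
    using orthonormal \<open>l \<noteq> 0\<close> by unfold_locales (auto dest: module_hom.zero)
  fix v assume v: "v \<in> carrier V"
  \<comment> \<open>At index -2 the operators \<open>vir_op\<close> and \<open>vir\<close> are not
    identified; there \<open>m = n\<close>, and the zero coefficient makes both sides
    vanish.\<close>
  have "of_int (m - n) \<odot>\<^bsub>V\<^esub> vir_op scale form l u d (m + n) v = of_int (m - n) \<odot>\<^bsub>V\<^esub> vir (m + n) v"
  proof (cases "m + n \<ge> -1")
    case True
    then show ?thesis by (simp only: vir_op_eq_vir v)
  next
    case False
    with \<open>m \<ge> -1\<close> \<open>n \<ge> -1\<close> have "m = n" by simp
    then show ?thesis using v vir_op_closed [OF v, of "m + n"] vir_closed [OF v, of "m + n"] by simp
  qed
  then show "vir_op scale form l u d m (vir_op scale form l u d n v)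
      \<ominus>\<^bsub>V\<^esub> vir_op scale form l u d n (vir_op scale form l u d m v)
      = of_int (m - n) \<odot>\<^bsub>V\<^esub> vir_op scale form l u d (m + n) v"
    using vir_commutator [OF v \<open>m \<ge> -1\<close> \<open>n \<ge> -1\<close>] v \<open>m \<ge> -1\<close> \<open>n \<ge> -1\<close>
    by (simp only: vir_op_eq_vir vir_closed)
qed

end
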